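(* Let $m,r,n$ be positive integers, $M\in\mathbb{R}^{m\times n}$ with $\operatorname{rk}(M)=s\le r$, and let $g:\mathbb{R}^{m\times n}\to\mathbb{R}$ satisfy: (A1) $g$ is convex; (A2) $M$ is the unique minimum of $g$ on $\mathbb{R}^{m\times n}$; (A3) there exist constants $c,\delta>0$ such that $g(A)\ge g(M)+c\|A-M\|_F^\beta$ for all $A\in\mathbb{R}^{m\times n}_{\le r}\cap B_\delta(M)$; in addition, either $\beta\in[1,2)$, or $\beta=2$ and $\sup_{G\in\partial g(A)}\|G\|_F\le\sigma_s(M)c/8$ for all $A\in\mathbb{R}^{m\times n}_{\le r}\cap B_\delta(M)$. Let $f:\mathbb{R}^{m\times r}\times\mathbb{R}^{r\times n}\to\mathbb{R}$, $f(X,Y):=g(XY)$, and let $(\overline{X},\overline{Y})$ be a global minimum of $f$. Then: (i) If $(\overline{X},\overline{Y})\in\mathcal{O}(p,q)$ with $p+q=r-s$, then $f$ has Kurdyka-Łojasiewicz exponent $1-1/\beta$ at $(\overline{X},\overline{Y})$. (ii) If $(\overline{X},\overline{Y})\in\mathcal{O}(p,q)$ with $p+q<r-s$, then $f$ has Kurdyka-Łojasiewicz exponent $1-1/(2\beta)$ at $(\overline{X},\overline{Y})$.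
   Context: $\mathbb{R}^{m\times n}_{\le r}$ is the set of $m\times n$ matrices of rank at most $r$; $\|\cdot\|_F$ is the Frobenius norm, $B_\delta(M)$ the Frobenius ball; $\partial g(A)$ the convex subdifferential; $\sigma_s(M)$ the $s$-th largest singular value of $M$ (its smallest nonzero one; when $s=0$, set $\sigma_0(M):=+\infty$, so the last bound is vacuous). The sets $\mathcal{O}(p,q)$: fix a singular value decomposition $M=U\begin{bmatrix}D&0\\0&0\end{bmatrix}V^\top$ with $U\in\mathrm{O}(m)$, $V\in\mathrm{O}(n)$ and $D\in\mathbb{R}^{s\times s}$ a positive diagonal matrix. For $p,q\in\mathbb{N}$ with $\min\{m-s-p,\,n-s-q,\,r-s-p-q\}\ge 0$, let $$\widehat X_p:=\begin{bmatrix}I_s&0&0&0\\0&I_p&0&0\\0&0&0&0\end{bmatrix}\in\mathbb{R}^{m\times r},\qquad \widehat Y_q:=\begin{bmatrix}D&0&0\\0&0&0\\0&I_q&0\\0&0&0\end{bmatrix}\in\mathbb{R}^{r\times n},$$ where the columns of $\widehat X_p$ and the rows of $\widehat Y_q$ are split into blocks of sizes $s,p,q,r-s-p-q$, the rows of $\widehat X_p$ into $s,p,m-s-p$, and the columns of $\widehat Y_q$ into $s,q,n-s-q$. Then $$\mathcal{O}(p,q):=\left\{\left(U\operatorname{diag}(I_s,Q_1)^\top\widehat X_pA,\;A^{-1}\widehat Y_q\operatorname{diag}(I_s,Q_2)V^\top\right): Q_1\in\mathrm{O}(m-s),\,A\in\mathrm{GL}(r),\,Q_2\in\mathrm{O}(n-s)\right\}.$$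 Kurdyka-Łojasiewicz exponent: a locally Lipschitz function $f$ on a Euclidean space has KŁ exponent $\alpha\in[0,1)$ at $\overline{x}$ if there exist $\rho,\ell,c>0$ such that $d(0,\overline\partial f(x))\ge c(f(x)-f(\overline{x}))^\alpha$ for all $x\in B_\rho(\overline{x})$ with $0<f(x)-f(\overline{x})<\ell$, where $\overline\partial f$ is the Clarke subdifferential and $d(0,S)=\inf_{v\in S}|v|$. *)

theory Defs
  imports "HOL-Analysis.Analysis"
begin

text \<open>
  \<open>('m, 'n) rmat\<close> is the type \<open>real^'n^'m\<close> of real matrices with rows indexed by \<open>'m\<close> and columns
  indexed by \<open>'n\<close>, written without \<open>^\<close> to leave the sorts of the index types open. The inner product and the norm
  of this type are the Frobenius inner product and the Frobenius norm. On pairs of matrices the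
  product type carries the Euclidean structure used below.
\<close>

type_synonym ('m, 'n) rmat = "((real, 'n) vec, 'm) vec"

section \<open>Singular values\<close>

definition gram_eigenspace :: "real^'n^'m \<Rightarrow> real \<Rightarrow> (real^'n) set" where
  "gram_eigenspace M t = {v. (transpose M ** M) *v v = t *\<^sub>R v}"

text \<open>
  Singular values are square roots of eigenvalues of \<open>M\<^sup>T M\<close>, so for \<open>n > m\<close> the value \<open>0\<close> gets a larger
  multiplicity than with the convention of \<open>min m n\<close> singular values. Positive singular values and
  their multiplicities are the same in both conventions.
\<close>

definition singular_values :: "real^'n^'m \<Rightarrow> real set" where
  "singular_values M = {\<sigma>. 0 \<le> \<sigma> \<and> (\<exists>v. v \<noteq> 0 \<and> v \<in> gram_eigenspace M (\<sigma>\<^sup>2))}"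

text \<open>
  The \<open>k\<close>-th largest singular value counted with multiplicity: the largest \<open>\<sigma>\<close> such that at least \<open>k\<close>
  singular values are \<open>\<ge> \<sigma>\<close>. By convention it is \<open>\<infinity>\<close> for \<open>k = 0\<close>; it is meaningful for
  \<open>k \<le> min m n\<close>.
\<close>

definition nth_singular_value :: "nat \<Rightarrow> real^'n^'m \<Rightarrow> ereal" where
  "nth_singular_value k M =
     (if k = 0 then \<infinity>
      else ereal (Max {\<sigma> \<in> singular_values M.
             k \<le> (\<Sum>\<tau> \<in> {\<tau> \<in> singular_values M. \<sigma> \<le> \<tau>}. dim (gram_eigenspace M (\<tau>\<^sup>2)))}))"

section \<open>Block matrices and the sets \<open>\<O>(p,q)\<close>\<close>

text \<open>
  Block partitions refer to the order of the index types: \<open>pos i\<close> is the position of the index \<open>i\<close>,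
  counted from \<open>0\<close>.
\<close>

definition pos :: "'a::{finite,linorder} \<Rightarrow> nat" where
  "pos i = card {..<i}"

text \<open>
  The positive diagonal matrix \<open>D\<close> of size \<open>s\<close> is given by its diagonal entries \<open>d 0, \<dots>, d (s - 1)\<close>.
\<close>

definition diag_block :: "nat \<Rightarrow> (nat \<Rightarrow> real) \<Rightarrow> ('m::{finite,linorder}, 'n::{finite,linorder}) rmat" where
  "diag_block s d = (\<chi> i j. if pos i = pos j \<and> pos i < s then d (pos i) else 0)"

definition is_svd ::
  "('m::{finite,linorder}, 'n::{finite,linorder}) rmat \<Rightarrow> nat \<Rightarrow> ('m, 'm) rmat \<Rightarrow> (nat \<Rightarrow> real) \<Rightarrow> ('n, 'n) rmat \<Rightarrow> bool"
  where
  "is_svd M s U d V \<longleftrightarrow>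
     orthogonal_matrix U \<and> orthogonal_matrix V \<and> (\<forall>k<s. 0 < d k) \<and>
     M = U ** diag_block s d ** transpose V"

text \<open>
  The matrices \<open>diag(I\<^sub>s, Q)\<close> with \<open>Q\<close> orthogonal: a matrix of this block shape is orthogonal iff \<open>Q\<close> is.
\<close>

definition id_orth_blocks :: "nat \<Rightarrow> ('k::{finite,linorder}, 'k) rmat set" where
  "id_orth_blocks s = {P. orthogonal_matrix P \<and>
     (\<forall>i j. pos i < s \<or> pos j < s \<longrightarrow> P $ i $ j = (if i = j then 1 else 0))}"

definition Xhat :: "nat \<Rightarrow> nat \<Rightarrow> ('m::{finite,linorder}, 'r::{finite,linorder}) rmat" where
  "Xhat s p = (\<chi> i j. if pos i = pos j \<and> pos i < s + p then 1 else 0)"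

text \<open>
  Row blocks of sizes \<open>s, p, q, r - s - p - q\<close>; column blocks of sizes \<open>s, q, n - s - q\<close>. The identity block
  sits in the third row block and the second column block.
\<close>

definition Yhat ::
  "nat \<Rightarrow> (nat \<Rightarrow> real) \<Rightarrow> nat \<Rightarrow> nat \<Rightarrow> ('r::{finite,linorder}, 'n::{finite,linorder}) rmat" where
  "Yhat s d p q = (\<chi> i j.
     if pos i < s \<and> pos j = pos i then d (pos i)
     else if s + p \<le> pos i \<and> pos i < s + p + q \<and> pos i = pos j + p then 1
     else 0)"

definition O_set ::
  "('m::{finite,linorder}, 'm) rmat \<Rightarrow> (nat \<Rightarrow> real) \<Rightarrow> ('n::{finite,linorder}, 'n) rmat \<Rightarrow> nat \<Rightarrow> nat \<Rightarrow> nat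
     \<Rightarrow> (('m, 'r::{finite,linorder}) rmat \<times> ('r, 'n) rmat) set" where
  "O_set U d V s p q =
     {(U ** transpose P ** Xhat s p ** A, matrix_inv A ** Yhat s d p q ** R ** transpose V) 
      | P (A :: ('r, 'r) rmat) R.
        P \<in> id_orth_blocks s \<and> invertible A \<and> R \<in> id_orth_blocks s}"

section \<open>Subdifferentials and the Kurdyka--Lojasiewicz exponent\<close>

definition convex_subdiff :: "('a::euclidean_space \<Rightarrow> real) \<Rightarrow> 'a \<Rightarrow> 'a set" where
  "convex_subdiff g x = {v. \<forall>y. g x + v \<bullet> (y - x) \<le> g y}"

definition locally_Lipschitz :: "('a::euclidean_space \<Rightarrow> real) \<Rightarrow> bool" where
  "locally_Lipschitz f \<longleftrightarrow> (\<forall>x. \<exists>e>0. \<exists>L. L-lipschitz_on (ball x e) f)"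

text \<open>
  Clarke's generalized directional derivative is the upper limit of \<open>(f (y + t v) - f y) / t\<close> as \<open>y \<rightarrow> x\<close> and
  \<open>t \<down> 0\<close>. It takes extended real values here, and is finite for locally Lipschitz \<open>f\<close>.
\<close>

definition clarke_dderiv :: "('a::euclidean_space \<Rightarrow> real) \<Rightarrow> 'a \<Rightarrow> 'a \<Rightarrow> ereal" where
  "clarke_dderiv f x v =
     Limsup (nhds x \<times>\<^sub>F at_right 0) (\<lambda>(y, t). ereal ((f (y + t *\<^sub>R v) - f y) / t))"

definition clarke_subdiff :: "('a::euclidean_space \<Rightarrow> real) \<Rightarrow> 'a \<Rightarrow> 'a set" where
  "clarke_subdiff f x = {\<xi>. \<forall>v. ereal (\<xi> \<bullet> v) \<le> clarke_dderiv f x v}"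

text \<open>
  The library's \<open>infdist\<close> is \<open>0\<close> on the empty set, but the Clarke subdifferential of a locally Lipschitz
  function is never empty. The power \<open>0 powr 0\<close> does not occur, as the base is positive.
\<close>

definition has_KL_exponent :: "('a::euclidean_space \<Rightarrow> real) \<Rightarrow> real \<Rightarrow> 'a \<Rightarrow> bool" where
  "has_KL_exponent f \<alpha> xb \<longleftrightarrow>
     locally_Lipschitz f \<and> 0 \<le> \<alpha> \<and> \<alpha> < 1 \<and>
     (\<exists>\<rho>>0. \<exists>l>0. \<exists>c>0. \<forall>x \<in> ball xb \<rho>. 0 < f x - f xb \<and> f x - f xb < l \<longrightarrow>
        c * (f x - f xb) powr \<alpha> \<le> infdist 0 (clarke_subdiff f x))"

end

theory Submission
  imports Defs
begin

text \<open>
  Why the theorem holds. Let \<open>A = X ** Y\<close> be near \<open>M\<close>, and write \<open>\<Delta> = A - M\<close>.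

  By the chain rule, a Clarke subgradient of \<open>f\<close> at \<open>(X, Y)\<close> is a functional \<open>(V, W) \<mapsto> G \<bullet> (V **
  Y + X ** W)\<close> with \<open>G\<close> a subgradient of \<open>g\<close> at \<open>A\<close> (\<open>clarke_subdiff_factorization\<close>). Suppose
  that directions \<open>V, W\<close> of size at most \<open>C * \<bar>\<Delta>\<bar>\<^sup>\<kappa>\<close> solve \<open>V ** Y + X ** W = M - A + E\<close>. The
  subgradient inequality then gives \<open>g A - g M \<le> \<bar>\<xi>\<bar> * C * \<bar>\<Delta>\<bar>\<^sup>\<kappa> + \<bar>G\<bar> * \<bar>E\<bar>\<close>. If the last term
  is at most half of the left side, the growth condition \<open>c * \<bar>\<Delta>\<bar>\<^sup>\<beta> \<le> g A - g M\<close> turns this into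
  a lower bound of \<open>\<bar>\<xi>\<bar>\<close> by a multiple of \<open>(g A - g M)\<close> to the power \<open>1 - \<kappa> / \<beta>\<close>
  (\<open>KL_exponent_from_tangent_steps\<close>). So everything depends on a solution of the approximate
  tangent equation with \<open>\<kappa> = 1\<close> in case (i), \<open>\<kappa> = 1/2\<close> in case (ii), and with \<open>\<bar>E\<bar> \<le> 2 * \<bar>\<Delta>\<bar>\<^sup>2 /
  \<sigma>\<^sub>s\<close>. For \<open>\<beta> < 2\<close> such an error is negligible against \<open>\<bar>\<Delta>\<bar>\<^sup>\<beta>\<close>; for \<open>\<beta> = 2\<close> the bound \<open>\<sigma>\<^sub>s * c
  / 8\<close> on the subgradients makes it at most a quarter of \<open>c * \<bar>\<Delta>\<bar>\<^sup>2\<close>.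

  To solve the equation, let \<open>Mp\<close> be the pseudoinverse of \<open>M\<close> and \<open>K\<close> its perturbation \<open>Mp ** (1
  + \<Delta> ** Mp)\<^sup>-\<^sup>1\<close>, which inverts \<open>A\<close> on the part of \<open>A\<close> that carries the \<open>s\<close> large singular
  values. Splitting \<open>A = A ** K ** A + R\<close>, the first summand can be moved to \<open>M\<close> by directions
  of size \<open>O(\<Delta>)\<close>, up to the error \<open>E\<close>. The second is the Schur complement \<open>R = X ** T ** Y\<close> with
  \<open>T = 1 - Y ** K ** X\<close>, and \<open>\<bar>R\<bar> = O(\<Delta>)\<close>. It is removed by \<open>V = - X ** \<Theta>\<close> and \<open>W = - (T - \<Theta>) **
  Y\<close> for any \<open>\<Theta>\<close>, so the question is how small both factors can be made simultaneously
  (\<open>approximate_tangent_step\<close>). In general \<open>R\<close> is a product of two factors, and a regularized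
  projection balances them at the scale \<open>\<bar>R\<bar>\<^sup>1\<^sup>/\<^sup>2\<close> (\<open>balanced_splitting\<close>). When \<open>p + q = r -
  s\<close>, the limits of the two factors are invertible on complementary subspaces of \<open>T\<close>'s range,
  and both can be made \<open>O(R)\<close> (\<open>splits_with_exponent_one\<close>).
\<close>

section \<open>The Frobenius norm and perturbations of the identity\<close>

lemma norm_matrix_eq_L2_set: "norm A = L2_set (\<lambda>i. norm (A $ i)) UNIV"
  by (simp add: norm_vec_def)

lemma norm_matrix_vector_mult_le: "norm (A *v x) \<le> norm A * norm x"
  for A :: "real^'n^'m"
proof -
  have "norm (A *v x) = L2_set (\<lambda>i. norm ((A *v x) $ i)) UNIV"
    by (rule norm_vec_def)
  also have "\<dots> \<le> L2_set (\<lambda>i. norm (A $ i) * norm x) UNIV"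
    by (rule L2_set_mono) (auto simp: matrix_vector_mul_component Cauchy_Schwarz_ineq2)
  also have "\<dots> = norm A * norm x"
    by (simp add: L2_set_left_distrib norm_matrix_eq_L2_set)
  finally show ?thesis .
qed

lemma norm_transpose: "norm (transpose A) = norm A"
  for A :: "real^'n^'m"
proof -
  have "(norm (transpose A))\<^sup>2 = (\<Sum>i\<in>UNIV. \<Sum>j\<in>UNIV. (A $ j $ i)\<^sup>2)"
    unfolding norm_vec_def L2_set_def by (simp add: sum_nonneg transpose_def)
  also have "\<dots> = (norm A)\<^sup>2"
    unfolding norm_vec_def L2_set_def by (subst sum.swap) (simp add: sum_nonneg)
  finally show ?thesis
    by (simp add: power2_eq_iff_nonneg)
qed

text \<open>
  The constants in the case \<open>\<beta> = 2\<close> are too tight for the submultiplicativity of the Frobenius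
  norm alone: one factor has to be measured in the operator norm. The rows of \<open>A ** B\<close> are the
  images of the rows of \<open>A\<close> under \<open>transpose B\<close>.
\<close>

lemma norm_matrix_mult_le_operator_bound:
  fixes A :: "real^'k^'m" and B :: "real^'n^'k"
  assumes "\<And>x. norm (transpose B *v x) \<le> b * norm x" and "0 \<le> b"
  shows "norm (A ** B) \<le> norm A * b"
proof -
  have row: "(A ** B) $ i = transpose B *v (A $ i)" for i
    by (vector matrix_matrix_mult_def matrix_vector_mult_def transpose_def)
       (simp add: mult.commute)
  have "norm (A ** B) \<le> L2_set (\<lambda>i. norm (A $ i) * b) UNIV"
    unfolding norm_matrix_eq_L2_set[of "A ** B"] row
    by (rule L2_set_mono) (use assms(1) in \<open>simp_all add: mult.commute del: transpose_matrix_vector\<close>)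
  also have "\<dots> = norm A * b"
    using assms(2) by (simp add: L2_set_left_distrib norm_matrix_eq_L2_set)
  finally show ?thesis .
qed

lemma norm_matrix_mult_le: "norm (A ** B) \<le> norm A * norm B"
  for A :: "real^'k^'m" and B :: "real^'n^'k"
  by (rule norm_matrix_mult_le_operator_bound)
     (use norm_matrix_vector_mult_le[of "transpose B"] in \<open>auto simp: norm_transpose\<close>)

lemma norm_matrix_le_operator_bound:
  fixes A :: "real^'n^'m"
  assumes "\<And>x. norm (A *v x) \<le> b * norm x" and "0 \<le> b"
  shows "norm A \<le> norm (mat 1 :: real^'n^'n) * b"
proof -
  have "norm (mat 1 ** transpose A) \<le> norm (mat 1 :: real^'n^'n) * b"
    by (rule norm_matrix_mult_le_operator_bound) (use assms in auto)
  then show ?thesis by (simp add: norm_transpose)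
qed

lemma bounded_bilinear_matrix_mult:
  "bounded_bilinear ((**) :: real^'k^'m \<Rightarrow> real^'n^'k \<Rightarrow> real^'n^'m)"
proof
  show "\<exists>K. \<forall>(A :: real^'k^'m) (B :: real^'n^'k). norm (A ** B) \<le> norm A * norm B * K"
    by (rule exI[of _ 1]) (simp add: norm_matrix_mult_le)
qed (vector matrix_matrix_mult_def sum.distrib algebra_simps sum_distrib_left)+

lemmas tendsto_matrix_mult [tendsto_intros] =
  bounded_bilinear.tendsto[OF bounded_bilinear_matrix_mult]

lemmas matrix_mult_diff_left = bounded_bilinear.diff_left[OF bounded_bilinear_matrix_mult]
lemmas matrix_mult_diff_right = bounded_bilinear.diff_right[OF bounded_bilinear_matrix_mult]
lemmas matrix_mult_scaleR_left = bounded_bilinear.scaleR_left[OF bounded_bilinear_matrix_mult]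
lemmas matrix_mult_scaleR_right = bounded_bilinear.scaleR_right[OF bounded_bilinear_matrix_mult]
lemmas matrix_mult_minus_left = bounded_bilinear.minus_left[OF bounded_bilinear_matrix_mult]
lemmas matrix_mult_minus_right = bounded_bilinear.minus_right[OF bounded_bilinear_matrix_mult]
lemmas matrix_mult_add_left = bounded_bilinear.add_left[OF bounded_bilinear_matrix_mult]
lemmas matrix_mult_add_right = bounded_bilinear.add_right[OF bounded_bilinear_matrix_mult]
lemmas matrix_mult_zero_left = bounded_bilinear.zero_left[OF bounded_bilinear_matrix_mult]
lemmas matrix_mult_zero_right = bounded_bilinear.zero_right[OF bounded_bilinear_matrix_mult]

lemmas matrix_ring_simps =
  matrix_mult_diff_left matrix_mult_diff_right matrix_mult_add_left matrix_mult_add_right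
  matrix_mult_minus_left matrix_mult_minus_right matrix_mult_zero_left matrix_mult_zero_right
  matrix_mul_assoc[symmetric]

lemma matrix_inv_cancel:
  fixes A :: "real^'n^'n"
  assumes "invertible A"
  shows "A ** matrix_inv A = mat 1" "matrix_inv A ** A = mat 1"
    "A ** (matrix_inv A ** B) = B" "matrix_inv A ** (A ** B) = B"
proof -
  have "A ** matrix_inv A = mat 1 \<and> matrix_inv A ** A = mat 1"
    unfolding matrix_inv_def by (rule someI_ex) (use assms in \<open>auto simp: invertible_def\<close>)
  then show "A ** matrix_inv A = mat 1" "matrix_inv A ** A = mat 1"
    "A ** (matrix_inv A ** B) = B" "matrix_inv A ** (A ** B) = B"
    by (auto simp: matrix_mul_assoc)
qed

text \<open>
  A matrix that shrinks no vector to less than a fixed fraction of its length is injective, and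
  its inverse inherits the reciprocal bound.
\<close>

lemma invertible_if_bounded_below:
  fixes A :: "real^'n^'n"
  assumes "\<And>x. b * norm x \<le> norm (A *v x)" and "0 < b"
  shows "invertible A" and "norm (matrix_inv A *v x) \<le> norm x / b"
proof -
  have "x = 0" if "A *v x = 0" for x
    using assms(1)[of x] \<open>0 < b\<close> that by (simp add: mult_le_0_iff)
  then show inv: "invertible A"
    unfolding invertible_left_inverse matrix_left_invertible_ker by blast
  have "b * norm (matrix_inv A *v x) \<le> norm x"
    using assms(1)[of "matrix_inv A *v x"] matrix_inv_cancel(1)[OF inv]
    by (simp add: matrix_vector_mul_assoc)
  then show "norm (matrix_inv A *v x) \<le> norm x / b"
    using \<open>0 < b\<close> by (simp add: field_simps)
qed

lemma
  fixes N :: "real^'n^'n"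
  assumes "norm N \<le> 1/2"
  shows invertible_mat_1_plus: "invertible (mat 1 + N)"
    and norm_inv_mat_1_plus: "norm (matrix_inv (mat 1 + N)) \<le> 2 * norm (mat 1 :: real^'n^'n)"
proof -
  have below: "1/2 * norm x \<le> norm ((mat 1 + N) *v x)" for x
  proof -
    have "norm (N *v x) \<le> 1/2 * norm x"
      using norm_matrix_vector_mult_le[of N x] mult_right_mono[OF assms norm_ge_zero[of x]] by simp
    then show ?thesis
      using norm_diff_ineq[of x "N *v x"] by (simp add: matrix_vector_mult_add_rdistrib)
  qed
  show "invertible (mat 1 + N)"
    by (rule invertible_if_bounded_below(1)[OF below]) simp
  have "norm (matrix_inv (mat 1 + N)) \<le> norm (mat 1 :: real^'n^'n) * 2"
    by (rule norm_matrix_le_operator_bound) (use invertible_if_bounded_below(2)[OF below] in \<open>auto simp: mult.commute\<close>)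
  then show "norm (matrix_inv (mat 1 + N)) \<le> 2 * norm (mat 1 :: real^'n^'n)"
    by simp
qed

lemma eventually_norm_le_half:
  assumes "(N \<longlongrightarrow> 0) F"
  shows "\<forall>\<^sub>F x in F. norm (N x :: 'a::real_normed_vector) \<le> 1/2"
proof -
  have "\<forall>\<^sub>F x in F. dist (N x) 0 < 1/2"
    using assms by (rule tendstoD) simp
  then show ?thesis by eventually_elim simp
qed

lemma tendsto_inv_mat_1_plus:
  fixes N :: "'a \<Rightarrow> real^'n^'n"
  assumes "(N \<longlongrightarrow> 0) F"
  shows "((\<lambda>x. matrix_inv (mat 1 + N x)) \<longlongrightarrow> mat 1) F"
proof -
  have "((\<lambda>x. matrix_inv (mat 1 + N x) - mat 1) \<longlongrightarrow> 0) F"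
  proof (rule Lim_null_comparison)
    show "((\<lambda>x. 2 * norm (mat 1 :: real^'n^'n) * norm (N x)) \<longlongrightarrow> 0) F"
      using assms by (auto intro!: tendsto_eq_intros)
    show "\<forall>\<^sub>F x in F. norm (matrix_inv (mat 1 + N x) - mat 1)
             \<le> 2 * norm (mat 1 :: real^'n^'n) * norm (N x)"
      using eventually_norm_le_half[OF assms]
    proof eventually_elim
      case (elim x)
      let ?B = "matrix_inv (mat 1 + N x)"
      have "?B ** (mat 1 + N x) = mat 1"
        by (rule matrix_inv_cancel(2)[OF invertible_mat_1_plus[OF elim]])
      then have "?B - mat 1 = - (?B ** N x)"
        by (simp add: matrix_ring_simps add_eq_0_iff algebra_simps)
      then have "norm (?B - mat 1) \<le> norm ?B * norm (N x)"
        using norm_matrix_mult_le[of ?B "N x"] by simp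
      also have "\<dots> \<le> 2 * norm (mat 1 :: real^'n^'n) * norm (N x)"
        by (rule mult_right_mono[OF norm_inv_mat_1_plus[OF elim]]) simp
      finally show ?case .
    qed
  qed
  then show ?thesis by (simp add: LIM_zero_iff)
qed

section \<open>Approximate tangent directions at a factorization\<close>

lemma norm_matrix_mult_le_operator_bound_left:
  fixes A :: "real^'k^'m" and B :: "real^'n^'k"
  assumes "\<And>x. norm (A *v x) \<le> a * norm x" and "0 \<le> a"
  shows "norm (A ** B) \<le> a * norm B"
proof -
  have "norm (transpose B ** transpose A) \<le> norm (transpose B) * a"
    by (rule norm_matrix_mult_le_operator_bound) (use assms in auto)
  then show ?thesis by (simp add: norm_transpose mult.commute flip: matrix_transpose_mul)
qed

text \<open>
  If \<open>Mp\<close> is the pseudoinverse of \<open>M\<close>, this is the generalized inverse of \<open>A\<close> that has the range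
  and the kernel of \<open>Mp\<close>. In bases adapted to \<open>M\<close> its only nonzero block is the inverse of the
  leading block of \<open>A\<close>.
\<close>

definition perturbed_inverse :: "real^'n^'m \<Rightarrow> real^'m^'n \<Rightarrow> real^'n^'m \<Rightarrow> real^'m^'n" where
  "perturbed_inverse M Mp A = Mp ** matrix_inv (mat 1 + (A - M) ** Mp)"

lemma transpose_add: "transpose (A + B) = transpose A + transpose B"
  for A :: "real^'n^'m"
  by (simp add: transpose_def vec_eq_iff)

text \<open>
  From \<open>K + K ** \<Delta> ** Mp = Mp\<close>, the operator norm of \<open>K\<close> is at most twice that of \<open>Mp\<close>. The
  projections onto the ranges of \<open>M\<close> and \<open>A ** K\<close> differ by \<open>(1 - M ** Mp) ** \<Delta> ** K\<close>, because
  \<open>M ** Mp ** A ** K = M ** Mp\<close>.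
\<close>

lemma norm_projection_diff_le:
  fixes M A :: "real^'n^'m" and Mp :: "real^'m^'n"
  defines "K \<equiv> perturbed_inverse M Mp A"
  assumes gen: "M ** Mp ** M = M" and sym: "transpose (M ** Mp) = M ** Mp"
    and a: "\<And>x. norm (transpose Mp *v x) \<le> a * norm x" "0 \<le> a"
    and small: "norm ((A - M) ** Mp) \<le> 1/2"
  shows "norm (M ** Mp - A ** K) \<le> norm (A - M) * (2 * a)"
proof -
  let ?D = "A - M" and ?P = "M ** Mp"
  define B where "B = matrix_inv (mat 1 + ?D ** Mp)"
  have B: "(mat 1 + ?D ** Mp) ** B = mat 1" "B ** (mat 1 + ?D ** Mp) = mat 1"
    unfolding B_def by (rule matrix_inv_cancel[OF invertible_mat_1_plus[OF small]])+
  have K: "K = Mp ** B" by (simp add: K_def perturbed_inverse_def B_def)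
  have "K + K ** (?D ** Mp) = Mp"
    using arg_cong[OF B(2), of "\<lambda>Z. Mp ** Z"] by (simp add: K matrix_ring_simps)
  then have KT: "transpose K + transpose (?D ** Mp) ** transpose K = transpose Mp"
    by (metis matrix_transpose_mul transpose_add)
  have Kx: "norm (transpose K *v x) \<le> 2 * a * norm x" for x
  proof -
    let ?z = "transpose K *v x"
    have "?z + transpose (?D ** Mp) *v ?z = transpose Mp *v x"
      unfolding KT[symmetric] by (simp only: matrix_vector_mult_add_rdistrib matrix_vector_mul_assoc)
    then have "norm ?z - norm (transpose (?D ** Mp) *v ?z) \<le> a * norm x"
      using a(1)[of x] norm_diff_ineq[of ?z "transpose (?D ** Mp) *v ?z"] by simp
    moreover have "norm (transpose (?D ** Mp) *v ?z) \<le> 1/2 * norm ?z"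
      using norm_matrix_vector_mult_le[of "transpose (?D ** Mp)" ?z] small
        mult_right_mono[OF small norm_ge_zero[of ?z]] by (simp add: norm_transpose)
    ultimately show ?thesis by simp
  qed
  have PM: "?P ** M = M" using gen .
  have "?P ** (A ** K) = ?P"
  proof -
    have "?P ** (A ** K) = ?P ** (?D ** K) + ?P ** (M ** K)"
      by (simp add: matrix_ring_simps)
    also have "\<dots> = ?P ** ((mat 1 + ?D ** Mp) ** B)"
      using PM by (simp add: K matrix_ring_simps) (simp add: matrix_mul_assoc)
    finally show ?thesis by (simp add: B(1))
  qed
  then have "?P - A ** K = - ((mat 1 - ?P) ** (A ** K))"
    by (simp add: matrix_ring_simps)
  also have "(mat 1 - ?P) ** (A ** K) = (mat 1 - ?P) ** (?D ** K)"
    using PM by (simp add: matrix_ring_simps) (simp add: matrix_mul_assoc)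
  finally have eq: "?P - A ** K = - ((mat 1 - ?P) ** (?D ** K))" .
  \<comment> \<open>The orthogonal projection \<open>mat 1 - ?P\<close> does not increase norms.\<close>
  have proj: "norm ((mat 1 - ?P) *v x) \<le> 1 * norm x" for x
  proof -
    let ?y = "(mat 1 - ?P) *v x"
    have idem: "?P ** ?P = ?P" using PM by (simp add: matrix_mul_assoc)
    then have Py: "?P *v ?y = 0"
      by (simp add: matrix_vector_mult_diff_rdistrib matrix_vector_mult_diff_distrib matrix_vector_mul_assoc)
    have "?y \<bullet> (?P *v x) = (transpose ?P *v ?y) \<bullet> x"
      by (simp add: dot_lmul_matrix[symmetric] flip: transpose_matrix_vector)
    then have "?y \<bullet> (?P *v x) = 0"
      unfolding sym Py by simp
    then have "(norm ?y)\<^sup>2 = ?y \<bullet> x"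
      by (simp add: power2_norm_eq_inner matrix_vector_mult_diff_rdistrib inner_diff_right)
    also have "\<dots> \<le> norm ?y * norm x" by (rule norm_cauchy_schwarz)
    finally show ?thesis
      by (cases "norm ?y = 0") (auto simp: power2_eq_square)
  qed
  have "norm (?P - A ** K) \<le> 1 * norm (?D ** K)"
    unfolding eq norm_minus_cancel by (rule norm_matrix_mult_le_operator_bound_left) (use proj in auto)
  also have "\<dots> \<le> norm ?D * (2 * a)"
    using norm_matrix_mult_le_operator_bound[of K "2 * a" ?D] Kx a(2) by simp
  finally show "norm (?P - A ** K) \<le> norm ?D * (2 * a)" .
qed

text \<open>
  The factors of a small product need not be small themselves. The regularized projection \<open>\<Psi> =
  l\<^sup>2 * (X\<^sup>T ** X + l\<^sup>2)\<^sup>-\<^sup>1\<close> is close to the identity on singular directions of \<open>X\<close> with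
  singular value below \<open>l\<close>, where \<open>X\<close> itself is small, and close to \<open>0\<close> on those above \<open>l\<close>,
  where \<open>Y\<close> is at most \<open>X ** Y\<close> divided by \<open>l\<close>.
\<close>

lemma balanced_splitting:
  fixes X :: "real^'r^'m" and Y :: "real^'n^'r"
  assumes l: "0 < l"
  shows "\<exists>\<Psi> :: real^'r^'r. norm (X ** \<Psi>) \<le> norm (mat 1 :: real^'r^'r) * l \<and>
           norm ((mat 1 - \<Psi>) ** Y) \<le> norm (X ** Y) / l"
proof -
  define S where "S = transpose X ** X + l\<^sup>2 *\<^sub>R mat 1"
  have Sz: "(S *v z) \<bullet> z = (norm (X *v z))\<^sup>2 + l\<^sup>2 * (norm z)\<^sup>2" for z
  proof -
    have "S *v z = transpose X *v (X *v z) + l\<^sup>2 *\<^sub>R z"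
      by (simp only: S_def matrix_vector_mult_add_rdistrib matrix_vector_mul_assoc
            scaleR_matrix_vector_assoc[symmetric] matrix_vector_mul_lid)
    moreover have "(transpose X *v (X *v z)) \<bullet> z = (X *v z) \<bullet> (X *v z)"
      by (simp add: dot_lmul_matrix)
    ultimately show ?thesis
      by (simp add: inner_add_left power2_norm_eq_inner)
  qed
  have "l\<^sup>2 * norm z \<le> norm (S *v z)" for z
  proof -
    have "l\<^sup>2 * (norm z)\<^sup>2 \<le> norm (S *v z) * norm z"
      using Sz[of z] norm_cauchy_schwarz[of "S *v z" z] zero_le_power2[of "norm (X *v z)"] by linarith
    then show ?thesis by (cases "norm z = 0") (auto simp: power2_eq_square)
  qed
  then have inv: "invertible S"
    by (rule invertible_if_bounded_below(1)) (use l in simp)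
  have S: "S *v (matrix_inv S *v x) = x" for x
    using matrix_inv_cancel(1)[OF inv] by (simp add: matrix_vector_mul_assoc)
  have bound1: "norm ((X ** matrix_inv S) *v x) \<le> 1 / l * norm x" for x
  proof -
    define z where "z = matrix_inv S *v x"
    have "(norm (X *v z))\<^sup>2 + l\<^sup>2 * (norm z)\<^sup>2 \<le> norm x * norm z"
      using Sz[of z] norm_cauchy_schwarz[of x z] S[of x] by (simp add: z_def)
    also have "norm x * norm z \<le> 2 * (norm x * norm z)"
      by simp
    also have "\<dots> \<le> (norm x / l)\<^sup>2 + l\<^sup>2 * (norm z)\<^sup>2"
      using l sum_squares_bound[of "norm x / l" "l * norm z"] by (simp add: power_mult_distrib)
    finally have "(norm (X *v z))\<^sup>2 \<le> (norm x / l)\<^sup>2" by simp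
    then have "norm (X *v z) \<le> norm x / l"
      using l by (rule_tac power2_le_imp_le) auto
    then show ?thesis by (simp add: z_def matrix_vector_mul_assoc)
  qed
  have bound2: "norm ((matrix_inv S ** transpose X) *v w) \<le> 1 / l * norm w" for w
  proof -
    define z where "z = matrix_inv S *v (transpose X *v w)"
    have "(transpose X *v w) \<bullet> z = w \<bullet> (X *v z)"
      by (simp add: dot_lmul_matrix)
    then have "(norm (X *v z))\<^sup>2 + l\<^sup>2 * (norm z)\<^sup>2 \<le> norm w * norm (X *v z)"
      using Sz[of z] norm_cauchy_schwarz[of w "X *v z"] S by (simp add: z_def)
    also have "norm w * norm (X *v z) \<le> 2 * norm w * norm (X *v z)"
      by simp
    also have "\<dots> \<le> (norm w)\<^sup>2 + (norm (X *v z))\<^sup>2"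
      by (rule sum_squares_bound)
    finally have "(l * norm z)\<^sup>2 \<le> (norm w)\<^sup>2" by (simp add: power_mult_distrib)
    then have "l * norm z \<le> norm w"
      by (rule power2_le_imp_le) simp
    then show ?thesis
      using l by (simp add: z_def matrix_vector_mul_assoc field_simps del: transpose_matrix_vector)
  qed
  define \<Psi> where "\<Psi> = l\<^sup>2 *\<^sub>R matrix_inv S"
  have "norm (X ** matrix_inv S) \<le> norm (mat 1 :: real^'r^'r) * (1 / l)"
    by (rule norm_matrix_le_operator_bound) (use bound1 l in auto)
  then have "norm (X ** \<Psi>) \<le> l\<^sup>2 * (norm (mat 1 :: real^'r^'r) * (1 / l))"
    unfolding \<Psi>_def matrix_mult_scaleR_right norm_scaleR by (intro mult_mono) auto
  also have "\<dots> = norm (mat 1 :: real^'r^'r) * l"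
    using l by (simp add: power2_eq_square)
  finally have 1: "norm (X ** \<Psi>) \<le> norm (mat 1 :: real^'r^'r) * l" .
  have "matrix_inv S ** transpose X ** X = mat 1 - \<Psi>"
    using matrix_inv_cancel(2)[OF inv] unfolding \<Psi>_def S_def[symmetric]
    by (subst (asm) (2) S_def) (simp add: matrix_ring_simps matrix_mult_scaleR_right eq_diff_eq)
  then have "(mat 1 - \<Psi>) ** Y = (matrix_inv S ** transpose X) ** (X ** Y)"
    by (metis matrix_mul_assoc)
  also have "norm \<dots> \<le> 1 / l * norm (X ** Y)"
    by (rule norm_matrix_mult_le_operator_bound_left) (use bound2 l in auto)
  finally have "norm ((mat 1 - \<Psi>) ** Y) \<le> norm (X ** Y) / l" by simp
  with 1 show ?thesis by blast
qed

text \<open>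
  The motion towards \<open>M\<close>: the left factor of \<open>A ** K ** A\<close> is corrected by the difference of the
  projections \<open>M ** Mp\<close> and \<open>A ** K\<close>, the right one by \<open>K ** (M - A)\<close>, and the Schur complement
  \<open>X ** (1 - Y ** K ** X) ** Y\<close> is divided between the two factors according to \<open>\<Theta>\<close>. What is
  left over is the product of the two corrections.
\<close>

lemma tangent_step_identity:
  fixes M :: "real^'n^'m" and X :: "real^'r^'m" and Y :: "real^'n^'r" and \<Theta> :: "real^'r^'r"
  assumes "M ** Mp ** M = M"
  shows "((M ** Mp - X ** Y ** K) ** X - X ** \<Theta>) ** Y
           + X ** (Y ** K ** (M - X ** Y) - (mat 1 - Y ** K ** X - \<Theta>) ** Y)
         = M - X ** Y - (M ** Mp - X ** Y ** K) ** (M - X ** Y)"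
proof -
  have "M ** (Mp ** M) = M" using assms by (simp add: matrix_mul_assoc)
  then show ?thesis by (simp add: matrix_ring_simps algebra_simps)
qed

lemma eventually_norm_le_limit_plus_1:
  assumes "(f \<longlongrightarrow> l) F"
  shows "\<forall>\<^sub>F x in F. norm (f x :: 'a::real_normed_vector) \<le> norm l + 1"
proof -
  have "\<forall>\<^sub>F x in F. norm (f x) < norm l + 1"
    using tendsto_norm[OF assms] by (rule order_tendstoD) simp
  then show ?thesis by eventually_elim simp
qed

lemma tendsto_imp_eventually_norm_bounded:
  fixes f :: "'a \<Rightarrow> 'b::real_normed_vector"
  assumes "(f \<longlongrightarrow> l) F"
  obtains c where "0 \<le> c" "\<forall>\<^sub>F x in F. norm (f x) \<le> c"
  using that[of "norm l + 1"] eventually_norm_le_limit_plus_1[OF assms] by simp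

text \<open>
  The symmetry of \<open>M ** Mp\<close> makes it an orthogonal projection; \<open>a\<close> plays the role of \<open>1 / \<sigma>\<^sub>s\<close>,
  and is \<open>0\<close> for \<open>M = 0\<close>.
\<close>

locale factorization_point =
  fixes M :: "real^'n^'m" and Mp :: "real^'m^'n" and a :: real
    and Xb :: "real^'r^'m" and Yb :: "real^'n^'r"
  assumes gen: "M ** Mp ** M = M" and sym: "transpose (M ** Mp) = M ** Mp"
    and a: "\<And>x. norm (transpose Mp *v x) \<le> a * norm x" "0 \<le> a"
    and factorization: "Xb ** Yb = M"
begin

abbreviation "near \<equiv> nhds (Xb, Yb)"
abbreviation "prd z \<equiv> fst z ** (snd z :: real^'n^'r) :: real^'n^'m"
abbreviation "err z \<equiv> norm (prd z - M)"
abbreviation "K z \<equiv> perturbed_inverse M Mp (prd z)"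

text \<open>
  The oblique projection of the inner space along the \<open>s\<close> directions that carry the large
  singular values of the product.
\<close>

definition T :: "(real^'r^'m) \<times> (real^'n^'r) \<Rightarrow> real^'r^'r" where
  "T z = mat 1 - snd z ** K z ** fst z"

lemma tendsto_fst_near: "(fst \<longlongrightarrow> Xb) near" and tendsto_snd_near: "(snd \<longlongrightarrow> Yb) near"
  using tendsto_fst[OF filterlim_ident, of "(Xb, Yb)"] tendsto_snd[OF filterlim_ident, of "(Xb, Yb)"]
  by simp_all

lemma tendsto_prd: "(prd \<longlongrightarrow> M) near"
  using tendsto_matrix_mult[OF tendsto_fst_near tendsto_snd_near] by (simp add: factorization)

lemma tendsto_defect: "((\<lambda>z. (prd z - M) ** Mp) \<longlongrightarrow> 0) near"
  using tendsto_matrix_mult[OF tendsto_diff[OF tendsto_prd tendsto_const] tendsto_const, of M Mp]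
  by (simp add: matrix_mult_zero_left)

lemma tendsto_K: "(K \<longlongrightarrow> Mp) near"
  using tendsto_matrix_mult[OF tendsto_const tendsto_inv_mat_1_plus[OF tendsto_defect], of Mp]
  by (simp add: perturbed_inverse_def)

lemma tendsto_T: "(T \<longlongrightarrow> mat 1 - Yb ** Mp ** Xb) near"
  unfolding T_def
  by (intro tendsto_diff tendsto_matrix_mult tendsto_const tendsto_K tendsto_fst_near tendsto_snd_near)

lemma eventually_err_le_1: "\<forall>\<^sub>F z in near. err z \<le> 1"
proof -
  have "((\<lambda>z. prd z - M) \<longlongrightarrow> 0) near"
    using tendsto_diff[OF tendsto_prd tendsto_const, of M] by simp
  from eventually_norm_le_half[OF this] show ?thesis by eventually_elim simp
qed

text \<open>
  At \<open>A = M\<close> the residual \<open>A - A ** K ** A\<close> vanishes, so it is of the order of \<open>A - M\<close>.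
\<close>

lemma eventually_residual_le: "\<exists>C\<ge>0. \<forall>\<^sub>F z in near. norm (fst z ** T z ** snd z) \<le> C * err z"
proof (intro exI conjI)
  let ?C = "2 * a * norm M + 1 + (norm M + 1) * (norm Mp + 1)"
  show "0 \<le> ?C" using a(2) by simp
  show "\<forall>\<^sub>F z in near. norm (fst z ** T z ** snd z) \<le> ?C * err z"
    using eventually_norm_le_half[OF tendsto_defect] eventually_norm_le_limit_plus_1[OF tendsto_prd]
      eventually_norm_le_limit_plus_1[OF tendsto_K]
  proof eventually_elim
    case (elim z)
    let ?A = "prd z" and ?K = "K z"
    have eq: "fst z ** T z ** snd z = (M ** Mp - ?A ** ?K) ** M + (?A - M) - ?A ** ?K ** (?A - M)"
      using gen by (simp add: T_def matrix_ring_simps)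
    have "norm (fst z ** T z ** snd z)
        \<le> norm ((M ** Mp - ?A ** ?K) ** M) + norm (?A - M) + norm (?A ** ?K ** (?A - M))"
      unfolding eq by (rule order_trans[OF norm_triangle_ineq4 add_right_mono[OF norm_triangle_ineq]])
    also have "\<dots> \<le> err z * (2 * a) * norm M + err z + (norm M + 1) * (norm Mp + 1) * err z"
    proof -
      have "norm ((M ** Mp - ?A ** ?K) ** M) \<le> err z * (2 * a) * norm M"
        by (rule order_trans[OF norm_matrix_mult_le
              mult_right_mono[OF norm_projection_diff_le[OF gen sym a elim(1)] norm_ge_zero]])
      moreover have "norm (?A ** ?K) \<le> (norm M + 1) * (norm Mp + 1)"
        by (rule order_trans[OF norm_matrix_mult_le mult_mono[OF elim(2) elim(3)]]) simp_all
      then have "norm (?A ** ?K ** (?A - M)) \<le> (norm M + 1) * (norm Mp + 1) * err z"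
        by (rule order_trans[OF norm_matrix_mult_le mult_right_mono]) simp
      ultimately show ?thesis by linarith
    qed
    also have "\<dots> = ?C * err z" by (simp add: algebra_simps)
    finally show ?case .
  qed
qed

text \<open>
  The rate at which the Schur complement can be divided between its two factors. It decides the
  exponent, because all other parts of the tangent directions are of size \<open>err\<close>.
\<close>

definition splits_with_exponent :: "real \<Rightarrow> bool" where
  "splits_with_exponent \<kappa> \<longleftrightarrow> (\<exists>C\<ge>0. \<forall>\<^sub>F z in near. prd z \<noteq> M \<longrightarrow>
     (\<exists>\<Theta>. norm (fst z ** \<Theta>) \<le> C * err z powr \<kappa> \<and> norm ((T z - \<Theta>) ** snd z) \<le> C * err z powr \<kappa>))"

text \<open>
  The balanced splitting of \<open>X ** T\<close> and \<open>Y\<close> at the scale \<open>err\<^sup>1\<^sup>/\<^sup>2\<close>.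
\<close>

lemma splits_with_exponent_half: "splits_with_exponent (1 / 2)"
proof -
  obtain C where C: "0 \<le> C" and ev: "\<forall>\<^sub>F z in near. norm (fst z ** T z ** snd z) \<le> C * err z"
    using eventually_residual_le by blast
  let ?n = "norm (mat 1 :: real^'r^'r)"
  let ?t = "norm (mat 1 - Yb ** Mp ** Xb) + 1"
  show ?thesis
    unfolding splits_with_exponent_def
  proof (intro exI conjI)
    show "0 \<le> ?n + ?t * C" using C by (intro add_nonneg_nonneg mult_nonneg_nonneg) auto
    show "\<forall>\<^sub>F z in near. prd z \<noteq> M \<longrightarrow>
      (\<exists>\<Theta>. norm (fst z ** \<Theta>) \<le> (?n + ?t * C) * err z powr (1/2) \<and>
            norm ((T z - \<Theta>) ** snd z) \<le> (?n + ?t * C) * err z powr (1/2))"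
      using ev eventually_norm_le_limit_plus_1[OF tendsto_T]
    proof (eventually_elim, intro impI)
      fix z assume R: "norm (fst z ** T z ** snd z) \<le> C * err z" and T: "norm (T z) \<le> ?t"
        and ne: "prd z \<noteq> M"
      \<comment> \<open>At this scale \<open>l\<close> and \<open>err z / l\<close> coincide.\<close>
      define l where "l = err z powr (1/2)"
      have l: "0 < l" using ne by (simp add: l_def)
      have err: "err z = l * l" using ne by (simp add: l_def flip: powr_add)
      obtain \<Psi> :: "real^'r^'r" where 1: "norm (fst z ** T z ** \<Psi>) \<le> ?n * l"
        and 2: "norm ((mat 1 - \<Psi>) ** snd z) \<le> norm (fst z ** T z ** snd z) / l"
        using balanced_splitting[OF l, of "fst z ** T z" "snd z"] by blast
      have "norm (fst z ** T z ** snd z) / l \<le> C * l"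
        using R l by (simp add: err pos_divide_le_eq mult.assoc)
      with 2 have "norm (T z ** ((mat 1 - \<Psi>) ** snd z)) \<le> ?t * (C * l)"
        by (rule_tac order_trans[OF norm_matrix_mult_le], intro mult_mono T) auto
      moreover have "0 \<le> ?n * l" "0 \<le> ?t * (C * l)" using l C by auto
      ultimately have "norm (fst z ** (T z ** \<Psi>)) \<le> (?n + ?t * C) * l \<and>
          norm ((T z - T z ** \<Psi>) ** snd z) \<le> (?n + ?t * C) * l"
        using 1 by (simp add: matrix_ring_simps distrib_right mult.assoc)
      then show "\<exists>\<Theta>. norm (fst z ** \<Theta>) \<le> (?n + ?t * C) * err z powr (1/2) \<and>
            norm ((T z - \<Theta>) ** snd z) \<le> (?n + ?t * C) * err z powr (1/2)"
        unfolding l_def by blast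
    qed
  qed
qed

text \<open>
  In the limit, \<open>N'\<close> inverts \<open>X ** T\<close> on the range of \<open>J\<close>, and \<open>N\<close> is a right inverse of \<open>Y\<close>
  over the kernel of \<open>J\<close>. Near the limit, let \<open>Z\<close> be the Schur complement of \<open>X ** T\<close> with
  respect to the part inverted by the perturbation \<open>B ** N'\<close> of \<open>N'\<close>. It kills the range of \<open>J\<close>,
  and its product with \<open>Y\<close> is of the order of \<open>X ** T ** Y\<close>. As the range of \<open>Y ** N\<close>
  complements that of \<open>J\<close>, the matrix \<open>Z\<close> is of that order itself.
\<close>

lemma splits_with_exponent_one:
  fixes N' :: "real^'m^'r" and N :: "real^'r^'n" and J :: "real^'r^'r"
  assumes J: "J ** J = J" and N': "N' ** Xb ** (mat 1 - Yb ** Mp ** Xb) = J"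
    and N: "Yb ** N + J = mat 1"
  shows "splits_with_exponent 1"
proof -
  obtain C where C: "0 \<le> C" and ev: "\<forall>\<^sub>F z in near. norm (fst z ** T z ** snd z) \<le> C * err z"
    using eventually_residual_le by blast
  define D where "D z = N' ** (fst z ** T z) - J" for z
  define W where "W z = snd z ** N + J - mat 1" for z :: "(real^'r^'m) \<times> (real^'n^'r)"
  define B where "B z = matrix_inv (mat 1 + D z)" for z
  have XT: "((\<lambda>z. fst z ** T z) \<longlongrightarrow> Xb ** (mat 1 - Yb ** Mp ** Xb)) near"
    by (intro tendsto_matrix_mult tendsto_fst_near tendsto_T)
  have "(D \<longlongrightarrow> N' ** (Xb ** (mat 1 - Yb ** Mp ** Xb)) - J) near"
    unfolding D_def by (intro tendsto_diff tendsto_matrix_mult[OF tendsto_const] XT tendsto_const)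
  then have D: "(D \<longlongrightarrow> 0) near"
    using N' by (simp add: matrix_mul_assoc)
  have "(W \<longlongrightarrow> Yb ** N + J - mat 1) near"
    unfolding W_def by (intro tendsto_diff tendsto_add tendsto_matrix_mult tendsto_snd_near tendsto_const)
  then have W: "(W \<longlongrightarrow> 0) near" by (simp add: N)
  have B: "(B \<longlongrightarrow> mat 1) near"
    unfolding B_def by (rule tendsto_inv_mat_1_plus[OF D])
  have lim1: "((\<lambda>z. T z ** B z ** N') \<longlongrightarrow> (mat 1 - Yb ** Mp ** Xb) ** mat 1 ** N') near"
    by (intro tendsto_matrix_mult B tendsto_T tendsto_const)
  have lim2: "((\<lambda>z. mat 1 - fst z ** T z ** B z ** N') \<longlongrightarrow>
      mat 1 - Xb ** (mat 1 - Yb ** Mp ** Xb) ** mat 1 ** N') near"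
    by (intro tendsto_diff tendsto_matrix_mult[OF tendsto_matrix_mult[OF XT B]] tendsto_const)
  have lim3: "((\<lambda>z. N ** matrix_inv (mat 1 + W z)) \<longlongrightarrow> N ** mat 1) near"
    by (intro tendsto_matrix_mult tendsto_inv_mat_1_plus[OF W] tendsto_const)
  obtain c1 where c1: "0 \<le> c1" and b1: "\<forall>\<^sub>F z in near. norm (T z ** B z ** N') \<le> c1"
    by (rule tendsto_imp_eventually_norm_bounded[OF lim1])
  obtain c2 where c2: "0 \<le> c2" and b2: "\<forall>\<^sub>F z in near. norm (mat 1 - fst z ** T z ** B z ** N') \<le> c2"
    by (rule tendsto_imp_eventually_norm_bounded[OF lim2])
  obtain c3 where c3: "0 \<le> c3" and b3: "\<forall>\<^sub>F z in near. norm (N ** matrix_inv (mat 1 + W z)) \<le> c3"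
    by (rule tendsto_imp_eventually_norm_bounded[OF lim3])
  note c = c1 c2 c3
  show ?thesis
    unfolding splits_with_exponent_def
  proof (intro exI conjI)
    show "0 \<le> c2 * C * c3 + c1 * C" using c C by simp
    show "\<forall>\<^sub>F z in near. prd z \<noteq> M \<longrightarrow>
      (\<exists>\<Theta>. norm (fst z ** \<Theta>) \<le> (c2 * C * c3 + c1 * C) * err z powr 1 \<and>
            norm ((T z - \<Theta>) ** snd z) \<le> (c2 * C * c3 + c1 * C) * err z powr 1)"
      using ev b1 b2 b3 eventually_norm_le_half[OF D] eventually_norm_le_half[OF W]
    proof (eventually_elim, intro impI)
      fix z
      assume R: "norm (fst z ** T z ** snd z) \<le> C * err z"
        and b: "norm (T z ** B z ** N') \<le> c1" "norm (mat 1 - fst z ** T z ** B z ** N') \<le> c2"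
          "norm (N ** matrix_inv (mat 1 + W z)) \<le> c3"
        and D: "norm (D z) \<le> 1/2" and W: "norm (W z) \<le> 1/2"
      define X where "X = fst z ** T z"
      define Y where "Y = snd z"
      define \<Theta> where "\<Theta> = T z - T z ** B z ** N' ** X"
      define Z where "Z = X - X ** B z ** N' ** X"
      have bound: "norm (Q ** (X ** Y)) \<le> c * (C * err z)" if "norm Q \<le> c" for Q :: "real^'m^'k" and c
        using R that order_trans[OF norm_ge_zero that] unfolding X_def Y_def
        by (rule_tac order_trans[OF norm_matrix_mult_le mult_mono]) auto
      have B: "B z ** (mat 1 + D z) = mat 1"
        unfolding B_def by (rule matrix_inv_cancel(2)[OF invertible_mat_1_plus[OF D]])
      have "mat 1 - B z ** N' ** X = B z ** (mat 1 + D z - N' ** X)"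
        by (simp add: matrix_mult_diff_right B matrix_mul_assoc)
      also have "mat 1 + D z - N' ** X = mat 1 - J"
        by (simp add: D_def X_def)
      finally have "(mat 1 - B z ** N' ** X) ** J = 0"
        using J by (simp add: matrix_ring_simps)
      then have "X ** ((mat 1 - B z ** N' ** X) ** J) = 0"
        by (simp add: matrix_mult_zero_right)
      then have ZJ: "Z ** J = 0"
        by (simp add: Z_def matrix_ring_simps)
      \<comment> \<open>\<open>mat 1 + W z = Y ** N + J\<close> is invertible near the limit, and \<open>Z\<close> vanishes on \<open>J\<close>.\<close>
      have "Z ** (mat 1 + W z) = Z ** (Y ** N)"
        using ZJ by (simp add: W_def Y_def matrix_mult_add_right)
      then have "Z ** (mat 1 + W z) ** matrix_inv (mat 1 + W z) = Z ** Y ** (N ** matrix_inv (mat 1 + W z))"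
        by (simp add: matrix_mul_assoc)
      then have "Z = Z ** Y ** (N ** matrix_inv (mat 1 + W z))"
        using matrix_inv_cancel(1)[OF invertible_mat_1_plus[OF W]]
        by (simp flip: matrix_mul_assoc)
      also have "Z ** Y = (mat 1 - X ** B z ** N') ** (X ** Y)"
        by (simp add: Z_def matrix_ring_simps)
      finally have "norm Z \<le> norm ((mat 1 - X ** B z ** N') ** (X ** Y)) * norm (N ** matrix_inv (mat 1 + W z))"
        by (metis norm_matrix_mult_le)
      also have "\<dots> \<le> c2 * (C * err z) * c3"
        by (rule mult_mono[OF _ b(3)], rule bound) (use b(2) c C in \<open>auto simp: X_def\<close>)
      finally have "norm Z \<le> c2 * C * c3 * err z" by (simp add: mult_ac)
      moreover have "fst z ** \<Theta> = Z"
        by (simp add: \<Theta>_def Z_def X_def matrix_ring_simps)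
      moreover have "(T z - \<Theta>) ** snd z = T z ** B z ** N' ** (X ** Y)"
        by (simp add: \<Theta>_def Y_def matrix_ring_simps)
      moreover have "norm (T z ** B z ** N' ** (X ** Y)) \<le> c1 * (C * err z)"
        by (rule bound) (use b(1) in auto)
      moreover have "0 \<le> c2 * C * c3 * err z" "0 \<le> c1 * (C * err z)" using c C by auto
      ultimately have "norm (fst z ** \<Theta>) \<le> (c2 * C * c3 + c1 * C) * err z \<and>
            norm ((T z - \<Theta>) ** snd z) \<le> (c2 * C * c3 + c1 * C) * err z"
        by (simp add: distrib_right mult.assoc)
      then show "\<exists>\<Theta>. norm (fst z ** \<Theta>) \<le> (c2 * C * c3 + c1 * C) * err z powr 1 \<and>
            norm ((T z - \<Theta>) ** snd z) \<le> (c2 * C * c3 + c1 * C) * err z powr 1"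
        by auto
    qed
  qed
qed

text \<open>
  The corrections from \<open>tangent_step_identity\<close> are of size \<open>err\<close>, which is at most \<open>err\<^sup>\<kappa>\<close>,
  except for the splitting of the Schur complement; and the product left over is of second
  order.
\<close>

lemma approximate_tangent_step:
  assumes "splits_with_exponent \<kappa>" and \<kappa>: "\<kappa> \<le> 1"
  shows "\<exists>C>0. \<forall>\<^sub>F z in near. prd z \<noteq> M \<longrightarrow>
    (\<exists>V W E. V ** snd z + fst z ** W = M - prd z + E \<and>
       norm (V, W) \<le> C * err z powr \<kappa> \<and> norm E \<le> 2 * a * (err z)\<^sup>2)"
proof -
  obtain C where C: "0 \<le> C" and ev: "\<forall>\<^sub>F z in near. prd z \<noteq> M \<longrightarrow>
     (\<exists>\<Theta>. norm (fst z ** \<Theta>) \<le> C * err z powr \<kappa> \<and> norm ((T z - \<Theta>) ** snd z) \<le> C * err z powr \<kappa>)"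
    using assms(1) unfolding splits_with_exponent_def by blast
  let ?C = "2 * a * (norm Xb + 1) + (norm Yb + 1) * (norm Mp + 1) + 2 * C + 1"
  have pos: "0 < ?C"
    using a(2) C by (intro add_nonneg_pos add_nonneg_nonneg mult_nonneg_nonneg) auto
  have "\<forall>\<^sub>F z in near. prd z \<noteq> M \<longrightarrow>
    (\<exists>V W E. V ** snd z + fst z ** W = M - prd z + E \<and>
       norm (V, W) \<le> ?C * err z powr \<kappa> \<and> norm E \<le> 2 * a * (err z)\<^sup>2)"
    using ev eventually_norm_le_half[OF tendsto_defect] eventually_err_le_1
      eventually_norm_le_limit_plus_1[OF tendsto_fst_near] eventually_norm_le_limit_plus_1[OF tendsto_snd_near]
      eventually_norm_le_limit_plus_1[OF tendsto_K]
  proof (eventually_elim, intro impI)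
    fix z
    assume *: "prd z \<noteq> M \<longrightarrow> (\<exists>\<Theta>. norm (fst z ** \<Theta>) \<le> C * err z powr \<kappa> \<and>
        norm ((T z - \<Theta>) ** snd z) \<le> C * err z powr \<kappa>)"
      and small: "norm ((prd z - M) ** Mp) \<le> 1/2" and err1: "err z \<le> 1"
      and X: "norm (fst z) \<le> norm Xb + 1" and Y: "norm (snd z) \<le> norm Yb + 1"
      and K: "norm (K z) \<le> norm Mp + 1" and ne: "prd z \<noteq> M"
    obtain \<Theta> where \<Theta>: "norm (fst z ** \<Theta>) \<le> C * err z powr \<kappa>"
        "norm ((T z - \<Theta>) ** snd z) \<le> C * err z powr \<kappa>"
      using * ne by blast
    let ?Q = "M ** Mp - prd z ** K z"
    have Q: "norm ?Q \<le> err z * (2 * a)"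
      by (rule norm_projection_diff_le[OF gen sym a small])
    have err: "err z \<le> err z powr \<kappa>"
      using powr_mono'[OF \<kappa>, of "err z"] err1 ne by simp
    define V where "V = ?Q ** fst z - fst z ** \<Theta>"
    define W where "W = snd z ** K z ** (M - prd z) - (T z - \<Theta>) ** snd z"
    define E where "E = - (?Q ** (M - prd z))"
    have "V ** snd z + fst z ** W = M - prd z + E"
      using tangent_step_identity[OF gen, of "fst z" "snd z" "K z" \<Theta>]
      by (simp add: V_def W_def E_def T_def)
    moreover have "norm E \<le> 2 * a * (err z)\<^sup>2"
    proof -
      have "norm E \<le> norm ?Q * err z"
        unfolding E_def norm_minus_cancel using norm_matrix_mult_le[of ?Q "M - prd z"]
        by (simp add: norm_minus_commute)
      also have "\<dots> \<le> err z * (2 * a) * err z" by (intro mult_right_mono Q) simp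
      finally show ?thesis by (simp add: power2_eq_square mult_ac)
    qed
    moreover have "norm (V, W) \<le> ?C * err z powr \<kappa>"
    proof -
      have "norm V \<le> norm (?Q ** fst z) + norm (fst z ** \<Theta>)"
        unfolding V_def by (rule norm_triangle_ineq4)
      also have "norm (?Q ** fst z) \<le> err z powr \<kappa> * (2 * a) * (norm Xb + 1)"
        by (rule order_trans[OF norm_matrix_mult_le])
           (intro mult_mono X order_trans[OF Q] err; use a(2) in simp)
      finally have V: "norm V \<le> (2 * a * (norm Xb + 1) + C) * err z powr \<kappa>"
        using \<Theta>(1) by (simp add: algebra_simps)
      have "norm W \<le> norm (snd z ** K z ** (M - prd z)) + norm ((T z - \<Theta>) ** snd z)"
        unfolding W_def by (rule norm_triangle_ineq4)
      also have "norm (snd z ** K z ** (M - prd z)) \<le> (norm Yb + 1) * (norm Mp + 1) * err z powr \<kappa>"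
      proof (rule order_trans[OF norm_matrix_mult_le], intro mult_mono)
        show "norm (snd z ** K z) \<le> (norm Yb + 1) * (norm Mp + 1)"
          by (rule order_trans[OF norm_matrix_mult_le]) (intro mult_mono Y K; simp)
        show "norm (M - prd z) \<le> err z powr \<kappa>" using err by (simp add: norm_minus_commute)
      qed simp_all
      finally have W: "norm W \<le> ((norm Yb + 1) * (norm Mp + 1) + C) * err z powr \<kappa>"
        using \<Theta>(2) by (simp add: algebra_simps)
      have "norm (V, W) \<le> norm V + norm W" by (rule norm_Pair_le)
      also have "\<dots> \<le> (?C - 1) * err z powr \<kappa>"
        using V W by (simp add: algebra_simps)
      also have "\<dots> \<le> ?C * err z powr \<kappa>" by (intro mult_right_mono) auto
      finally show ?thesis .
    qed
    ultimately show "\<exists>V W E. V ** snd z + fst z ** W = M - prd z + E \<and>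
       norm (V, W) \<le> ?C * err z powr \<kappa> \<and> norm E \<le> 2 * a * (err z)\<^sup>2"
      by blast
  qed
  then show ?thesis using pos by blast
qed

end

section \<open>Convex subgradients\<close>

text \<open>
  A chain rule in the form of a Hahn--Banach argument. The hypothesis says that the graph of an
  affine function over the affine subspace \<open>a + range L\<close> lies below the graph of \<open>g\<close>; a
  hyperplane that separates it from the strict epigraph of \<open>g\<close> contains it and is the graph of
  the required subgradient. With \<open>L = 0\<close> and \<open>\<xi> = 0\<close> this is the existence of subgradients.
\<close>

lemma subgradient_through_linear_map:
  fixes g :: "'a::euclidean_space \<Rightarrow> real" and L :: "'b::euclidean_space \<Rightarrow> 'a"
  assumes conv: "convex_on UNIV g" and lin: "linear L"
    and below: "\<And>v. g a + \<xi> \<bullet> v \<le> g (a + L v)"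
  obtains G where "G \<in> convex_subdiff g a" and "\<And>v. \<xi> \<bullet> v = G \<bullet> L v"
proof -
  define S where "S = {z :: 'a \<times> real. g (fst z) < snd z}"
  define T where "T = range (\<lambda>v. (a + L v, g a + \<xi> \<bullet> v))"
  have "convex S"
  proof (rule convexI)
    fix x y :: "'a \<times> real" and u v :: real
    assume x: "x \<in> S" and y: "y \<in> S" and uv: "0 \<le> u" "0 \<le> v" "u + v = 1"
    have "g (u *\<^sub>R fst x + v *\<^sub>R fst y) \<le> u * g (fst x) + v * g (fst y)"
      using conv uv by (auto simp: convex_on_def)
    also have "\<dots> < u * snd x + v * snd y"
    proof (cases "u = 0")
      case True
      then show ?thesis using y uv by (simp add: S_def)
    next
      case False
      then have "u * g (fst x) < u * snd x"
        using x uv by (simp add: S_def)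
      moreover have "v * g (fst y) \<le> v * snd y"
        using y uv by (intro mult_left_mono) (auto simp: S_def)
      ultimately show ?thesis by linarith
    qed
    finally show "u *\<^sub>R x + v *\<^sub>R y \<in> S" by (simp add: S_def)
  qed
  moreover have "convex T"
  proof (rule convexI)
    fix x y :: "'a \<times> real" and u v :: real
    assume "x \<in> T" "y \<in> T" and uv: "0 \<le> u" "0 \<le> v" "u + v = 1"
    then obtain x' y' where xy: "x = (a + L x', g a + \<xi> \<bullet> x')" "y = (a + L y', g a + \<xi> \<bullet> y')"
      by (auto simp: T_def)
    have v: "v = 1 - u" using uv by simp
    have "u *\<^sub>R x + v *\<^sub>R y = (a + L (u *\<^sub>R x' + v *\<^sub>R y'), g a + \<xi> \<bullet> (u *\<^sub>R x' + v *\<^sub>R y'))"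
      unfolding v by (simp add: xy linear_add[OF lin] linear_diff[OF lin] linear_scale[OF lin] algebra_simps)
    then show "u *\<^sub>R x + v *\<^sub>R y \<in> T" by (auto simp: T_def)
  qed
  moreover have "(a, g a + 1) \<in> S" "(a + L 0, g a + \<xi> \<bullet> 0) \<in> T"
    by (auto simp: S_def T_def)
  moreover have "S \<inter> T = {}"
    using below by (auto simp: S_def T_def not_less[symmetric])
  ultimately obtain c b where c: "c \<noteq> 0"
    and cS: "\<And>z. z \<in> S \<Longrightarrow> c \<bullet> z \<le> b" and cT: "\<And>z. z \<in> T \<Longrightarrow> b \<le> c \<bullet> z"
    using separating_hyperplane_sets[of S T] by blast
  obtain u w where uw: "c = (u, w)" by (cases c)
  have S: "u \<bullet> y + w * t \<le> b" if "g y < t" for y t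
    using cS[of "(y, t)"] that by (simp add: S_def uw)
  have T: "b \<le> u \<bullet> (a + L v) + w * (g a + \<xi> \<bullet> v)" for v
    using cT[of "(a + L v, g a + \<xi> \<bullet> v)"] by (auto simp: T_def uw)
  have base: "b \<le> u \<bullet> a + w * g a"
    using T[of 0] linear_0[OF lin] by simp
  have "w \<le> 0"
    using S[of a "g a + 1"] base by (simp add: algebra_simps)
  \<comment> \<open>A vertical hyperplane cannot separate, because the domain of \<open>g\<close> is the whole space.\<close>
  moreover have "w \<noteq> 0"
  proof
    assume w: "w = 0"
    then have "u \<bullet> u \<le> 0"
      using S[of "a + u" "g (a + u) + 1"] base by (simp add: inner_add_right)
    then have "u = 0" by (metis inner_eq_zero_iff inner_ge_zero order_antisym)
    then show False using w c uw by (simp add: zero_prod_def)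
  qed
  ultimately have w: "w < 0" by simp
  have Sle: "u \<bullet> y + w * g y \<le> b" for y
  proof (rule field_le_epsilon)
    fix e :: real assume "0 < e"
    then have "u \<bullet> y + w * (g y + e / - w) \<le> b"
      using w by (intro S) (simp add: field_simps)
    moreover have "w * (g y + e / - w) = w * g y - e"
      using w by (simp add: field_simps)
    ultimately show "u \<bullet> y + w * g y \<le> b + e" by simp
  qed
  define G where "G = (1 / - w) *\<^sub>R u"
  have u: "u = (- w) *\<^sub>R G" using w by (simp add: G_def)
  have b: "b = u \<bullet> a + w * g a" using Sle[of a] base by simp
  have *: "0 \<le> - w * (G \<bullet> L v) + w * (\<xi> \<bullet> v)" for v
    using T[of v] unfolding b u by (simp add: algebra_simps)
  have le: "\<xi> \<bullet> v \<le> G \<bullet> L v" for v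
  proof -
    have "w * (G \<bullet> L v) \<le> w * (\<xi> \<bullet> v)" using *[of v] by simp
    then show ?thesis using w by simp
  qed
  have "\<xi> \<bullet> v = G \<bullet> L v" for v
    using le[of v] le[of "- v"] by (simp add: linear_neg[OF lin])
  moreover have "G \<in> convex_subdiff g a"
    unfolding convex_subdiff_def
  proof safe
    fix y
    have "w * g y \<le> w * (g a + G \<bullet> (y - a))"
      using Sle[of y] unfolding b u by (simp add: algebra_simps)
    then show "g a + G \<bullet> (y - a) \<le> g y" using w by simp
  qed
  ultimately show ?thesis using that by blast
qed

lemma convex_subdiff_nonempty:
  fixes g :: "'a::euclidean_space \<Rightarrow> real"
  assumes "convex_on UNIV g"
  obtains G where "G \<in> convex_subdiff g a"
  using subgradient_through_linear_map[OF assms, of "\<lambda>_. 0 :: 'a" a 0]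
  by (metis inner_zero_left linear_zero order_refl add.right_neutral)

text \<open>
  A unit step in the direction of a subgradient \<open>G\<close> increases \<open>g\<close> by at least \<open>norm G\<close>, while
  \<open>g\<close> is bounded on compact sets.
\<close>

lemma convex_subdiff_locally_bounded:
  fixes g :: "'a::euclidean_space \<Rightarrow> real"
  assumes "convex_on UNIV g"
  obtains B where "\<And>y G. y \<in> ball a 1 \<Longrightarrow> G \<in> convex_subdiff g y \<Longrightarrow> norm G \<le> B"
proof -
  have "continuous_on UNIV g"
    using convex_on_continuous[OF open_UNIV assms] .
  then have "compact (g ` cball a 2)"
    by (intro compact_continuous_image) (auto intro: continuous_on_subset)
  then have "bounded (g ` cball a 2)"
    by (rule compact_imp_bounded)
  then obtain b where "\<forall>y\<in>cball a 2. \<bar>g y\<bar> \<le> b"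
    by (auto simp: bounded_iff simp del: mem_cball)
  then have b: "\<And>y. y \<in> cball a 2 \<Longrightarrow> \<bar>g y\<bar> \<le> b"
    by blast
  have "norm G \<le> 2 * b" if y: "y \<in> ball a 1" and G: "G \<in> convex_subdiff g y" for y G
  proof -
    define z where "z = y + sgn G"
    have "dist y z \<le> 1" by (simp add: z_def norm_sgn dist_norm)
    then have "z \<in> cball a 2" "y \<in> cball a 2"
      using y dist_triangle[of a z y] by auto
    then have "g z - g y \<le> 2 * b"
      using b[of z] b[of y] by linarith
    moreover have "g y + G \<bullet> sgn G \<le> g z"
      using G by (auto simp: convex_subdiff_def z_def dest!: spec[of _ "y + sgn G"])
    moreover have "G \<bullet> sgn G = norm G"
      by (cases "G = 0") (simp_all add: sgn_div_norm dot_square_norm power2_eq_square)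
    ultimately show ?thesis by simp
  qed
  then show ?thesis using that by blast
qed

lemma convex_imp_locally_Lipschitz:
  fixes g :: "'a::euclidean_space \<Rightarrow> real"
  assumes "convex_on UNIV g"
  shows "locally_Lipschitz g"
  unfolding locally_Lipschitz_def
proof
  fix a
  obtain B where B: "\<And>y G. y \<in> ball a 1 \<Longrightarrow> G \<in> convex_subdiff g y \<Longrightarrow> norm G \<le> B"
    by (rule convex_subdiff_locally_bounded[OF assms, of a]) blast
  have one_sided: "g y - g z \<le> B * norm (y - z)" if "y \<in> ball a 1" for y z
  proof -
    obtain G where G: "G \<in> convex_subdiff g y"
      using convex_subdiff_nonempty[OF assms] .
    then have "g y - g z \<le> G \<bullet> (y - z)"
      by (auto simp: convex_subdiff_def inner_diff_right dest!: spec[of _ z])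
    also have "\<dots> \<le> norm G * norm (y - z)" by (rule norm_cauchy_schwarz)
    also have "\<dots> \<le> B * norm (y - z)"
      using B[OF that G] by (intro mult_right_mono) auto
    finally show ?thesis .
  qed
  obtain G where "G \<in> convex_subdiff g a"
    using convex_subdiff_nonempty[OF assms] .
  then have "0 \<le> B" using B[of a G] norm_ge_zero[of G] by (simp del: norm_ge_zero)
  have "B-lipschitz_on (ball a 1) g"
  proof (rule lipschitz_onI)
    fix y z assume "y \<in> ball a 1" "z \<in> ball a 1"
    then show "dist (g y) (g z) \<le> B * dist y z"
      using one_sided[of y z] one_sided[of z y]
      by (simp add: dist_norm abs_le_iff norm_minus_commute)
  qed fact
  then show "\<exists>e>0. \<exists>L. L-lipschitz_on (ball a e) g" by (intro exI[of _ 1]) auto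
qed

section \<open>The Clarke subdifferential of a factorized convex function\<close>

text \<open>
  By convexity, the difference quotients with step \<open>t < 1\<close> along \<open>(V, W)\<close> are at most the
  increment of \<open>g\<close> over a full step in the direction \<open>V ** Y + X ** W + t * (V ** W)\<close>. This
  bound is continuous in the base point and in \<open>t\<close>, so it passes to the upper limit.
\<close>

lemma clarke_dderiv_factorization_le:
  fixes g :: "real^'n^'m \<Rightarrow> real" and X :: "real^'r^'m" and Y :: "real^'n^'r"
  assumes conv: "convex_on UNIV g"
  shows "clarke_dderiv (\<lambda>(X, Y). g (X ** Y)) (X, Y) (V, W)
           \<le> ereal (g (X ** Y + (V ** Y + X ** W)) - g (X ** Y))"
proof -
  let ?F = "nhds (X, Y) \<times>\<^sub>F at_right (0 :: real)"
  let ?h = "\<lambda>(z, t). g (fst z ** snd z + (V ** snd z + fst z ** W) + t *\<^sub>R (V ** W)) - g (fst z ** snd z)"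
  have cont: "continuous_on UNIV g"
    using convex_on_continuous[OF open_UNIV conv] .
  have fst: "(fst \<longlongrightarrow> (X, Y)) ?F"
    by (rule filterlim_fst)
  have at: "filterlim snd (at_right 0) ?F"
    by (rule filterlim_snd)
  then have snd: "(snd \<longlongrightarrow> 0) ?F"
    by (simp add: filterlim_at)
  have "((\<lambda>x. g (fst (fst x) ** snd (fst x) + (V ** snd (fst x) + fst (fst x) ** W) + snd x *\<^sub>R (V ** W))
            - g (fst (fst x) ** snd (fst x)))
          \<longlongrightarrow> g (X ** Y + (V ** Y + X ** W) + 0 *\<^sub>R (V ** W)) - g (X ** Y)) ?F"
    by (intro tendsto_diff continuous_on_tendsto_compose[OF cont] tendsto_add tendsto_matrix_mult
          tendsto_scaleR snd tendsto_const tendsto_fst[OF fst, simplified] tendsto_snd[OF fst, simplified]) auto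
  then have lim: "((\<lambda>x. ereal (?h x)) \<longlongrightarrow> ereal (g (X ** Y + (V ** Y + X ** W)) - g (X ** Y))) ?F"
    by (simp add: case_prod_unfold)
  have "\<forall>\<^sub>F t in at_right (0::real). t \<in> {0<..<1}"
    by (rule eventually_at_right_real) simp
  then have "\<forall>\<^sub>F x in ?F. snd x \<in> {0<..<1}"
    by (rule eventually_compose_filterlim[OF _ at])
  then have "\<forall>\<^sub>F x in ?F. (\<lambda>(z, t). ereal (((\<lambda>(X, Y). g (X ** Y)) (z + t *\<^sub>R (V, W)) - (\<lambda>(X, Y). g (X ** Y)) z) / t)) x \<le> ereal (?h x)"
  proof eventually_elim
    case (elim x)
    obtain A B t where x: "x = ((A, B), t)" by (metis prod.exhaust)
    have t: "0 < t" "t < 1" using elim by (auto simp: x)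
    let ?H = "(V ** B + A ** W) + t *\<^sub>R (V ** W)"
    have "(A + t *\<^sub>R V) ** (B + t *\<^sub>R W) = (1 - t) *\<^sub>R (A ** B) + t *\<^sub>R (A ** B + ?H)"
      by (simp add: matrix_ring_simps matrix_mult_scaleR_left matrix_mult_scaleR_right algebra_simps)
    then have "g ((A + t *\<^sub>R V) ** (B + t *\<^sub>R W)) \<le> (1 - t) * g (A ** B) + t * g (A ** B + ?H)"
      using conv t unfolding convex_on_def by simp
    then have "g ((A + t *\<^sub>R V) ** (B + t *\<^sub>R W)) - g (A ** B) \<le> (g (A ** B + ?H) - g (A ** B)) * t"
      by (simp add: algebra_simps)
    then show ?case
      using t by (simp add: x pos_divide_le_eq add.assoc)
  qed
  then have "clarke_dderiv (\<lambda>(X, Y). g (X ** Y)) (X, Y) (V, W) \<le> Limsup ?F (\<lambda>x. ereal (?h x))"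
    unfolding clarke_dderiv_def by (rule Limsup_mono)
  also have "\<dots> = ereal (g (X ** Y + (V ** Y + X ** W)) - g (X ** Y))"
    by (rule lim_imp_Limsup[OF _ lim]) (simp add: prod_filter_eq_bot)
  finally show ?thesis .
qed

lemma linear_product_derivative: "linear (\<lambda>v. fst v ** Y + X ** snd v)"
  for X :: "real^'r^'m" and Y :: "real^'n^'r"
  by (rule linearI)
     (simp_all add: matrix_ring_simps matrix_mult_scaleR_left matrix_mult_scaleR_right algebra_simps)

lemma clarke_subdiff_factorization:
  fixes g :: "real^'n^'m \<Rightarrow> real" and X :: "real^'r^'m" and Y :: "real^'n^'r"
  assumes conv: "convex_on UNIV g"
    and \<xi>: "\<xi> \<in> clarke_subdiff (\<lambda>(X, Y). g (X ** Y)) (X, Y)"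
  obtains G where "G \<in> convex_subdiff g (X ** Y)"
    and "\<And>V W. \<xi> \<bullet> (V, W) = G \<bullet> (V ** Y + X ** W)"
proof -
  have "g (X ** Y) + \<xi> \<bullet> v \<le> g (X ** Y + (fst v ** Y + X ** snd v))" for v
  proof -
    have "ereal (\<xi> \<bullet> (fst v, snd v)) \<le> ereal (g (X ** Y + (fst v ** Y + X ** snd v)) - g (X ** Y))"
      by (rule order_trans[OF _ clarke_dderiv_factorization_le[OF conv]])
         (use \<xi> in \<open>simp only: clarke_subdiff_def mem_Collect_eq\<close>)
    then show ?thesis by simp
  qed
  then obtain G where "G \<in> convex_subdiff g (X ** Y)" "\<And>v. \<xi> \<bullet> v = G \<bullet> (fst v ** Y + X ** snd v)"
    using subgradient_through_linear_map[OF conv linear_product_derivative] by blast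
  then show ?thesis using that[of G] by (metis fst_conv snd_conv)
qed

text \<open>
  Pulling a subgradient of \<open>g\<close> back through the derivative of the product gives a Clarke
  subgradient: the difference quotients at the base point itself already exceed it up to a term
  of order \<open>t\<close>. This matters because \<open>infdist\<close> would be \<open>0\<close> on the empty set.
\<close>

lemma clarke_subdiff_factorization_nonempty:
  fixes g :: "real^'n^'m \<Rightarrow> real" and X :: "real^'r^'m" and Y :: "real^'n^'r"
  assumes conv: "convex_on UNIV g"
  shows "clarke_subdiff (\<lambda>(X, Y). g (X ** Y)) (X, Y) \<noteq> {}"
proof -
  obtain G where G: "G \<in> convex_subdiff g (X ** Y)"
    using convex_subdiff_nonempty[OF conv] .
  define L where "L = (\<lambda>v. fst v ** Y + X ** snd v)"
  have lin: "linear L" unfolding L_def by (rule linear_product_derivative)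
  define \<xi> where "\<xi> = adjoint L G"
  have \<xi>: "\<xi> \<bullet> v = G \<bullet> L v" for v
    using adjoint_works[OF lin, of v G] by (simp add: \<xi>_def inner_commute)
  have "ereal (\<xi> \<bullet> v) \<le> clarke_dderiv (\<lambda>(X, Y). g (X ** Y)) (X, Y) v" for v
  proof (rule ccontr)
    obtain V W where v: "v = (V, W)" by (cases v)
    let ?q = "\<lambda>(z, t). ereal (((\<lambda>(X, Y). g (X ** Y)) (z + t *\<^sub>R (V, W)) - (\<lambda>(X, Y). g (X ** Y)) z) / t)"
    let ?F = "nhds (X, Y) \<times>\<^sub>F at_right (0 :: real)"
    assume "\<not> ?thesis"
    then have "Limsup ?F ?q < ereal (\<xi> \<bullet> v)"
      by (simp add: clarke_dderiv_def v)
    then obtain b where b: "Limsup ?F ?q < ereal b" "b < \<xi> \<bullet> v"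
      using ereal_dense2[of "Limsup ?F ?q" "ereal (\<xi> \<bullet> v)"] by auto
    then have "\<forall>\<^sub>F x in ?F. ?q x < ereal b"
      by (intro Limsup_lessD)
    then obtain P Q where "eventually P (nhds (X, Y))" and Q: "eventually Q (at_right (0::real))"
      and PQ: "\<And>z t. P z \<Longrightarrow> Q t \<Longrightarrow> ?q (z, t) < ereal b"
      unfolding eventually_prod_filter by blast
    from \<open>eventually P (nhds (X, Y))\<close> have P: "P (X, Y)"
      by (rule eventually_nhds_x_imp_x)
    have "\<forall>\<^sub>F t in at_right (0::real). \<xi> \<bullet> v + t * (G \<bullet> (V ** W)) \<le> b"
      using Q eventually_at_right_less[of 0]
    proof eventually_elim
      case (elim t)
      have "g (X ** Y) + G \<bullet> (t *\<^sub>R L v + t\<^sup>2 *\<^sub>R (V ** W)) \<le> g ((X + t *\<^sub>R V) ** (Y + t *\<^sub>R W))"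
      proof -
        have "(X + t *\<^sub>R V) ** (Y + t *\<^sub>R W) - X ** Y = t *\<^sub>R L v + t\<^sup>2 *\<^sub>R (V ** W)"
          by (simp add: L_def v matrix_ring_simps matrix_mult_scaleR_left matrix_mult_scaleR_right
                algebra_simps power2_eq_square)
        then show ?thesis
          using G unfolding convex_subdiff_def
          by (metis (no_types, lifting) mem_Collect_eq)
      qed
      moreover have "g ((X + t *\<^sub>R V) ** (Y + t *\<^sub>R W)) - g (X ** Y) < b * t"
        using PQ[OF P elim(1)] elim(2) by (simp add: pos_divide_less_eq)
      ultimately have "t * (\<xi> \<bullet> v + t * (G \<bullet> (V ** W))) \<le> t * b"
        by (simp add: \<xi> inner_add_right algebra_simps power2_eq_square)
      then show ?case using elim(2) by simp
    qed
    moreover have "((\<lambda>t. \<xi> \<bullet> v + t * (G \<bullet> (V ** W))) \<longlongrightarrow> \<xi> \<bullet> v + 0 * (G \<bullet> (V ** W))) (at_right 0)"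
      by (intro tendsto_intros)
    ultimately have "\<xi> \<bullet> v + 0 * (G \<bullet> (V ** W)) \<le> b"
      by (intro tendsto_upperbound) auto
    then show False using b by simp
  qed
  then have "\<xi> \<in> clarke_subdiff (\<lambda>(X, Y). g (X ** Y)) (X, Y)"
    unfolding clarke_subdiff_def by blast
  then show ?thesis by blast
qed

lemma locally_Lipschitz_factorization:
  fixes g :: "real^'n^'m \<Rightarrow> real"
  assumes "locally_Lipschitz g"
  shows "locally_Lipschitz (\<lambda>(X :: real^'r^'m, Y). g (X ** Y))"
  unfolding locally_Lipschitz_def
proof
  fix z :: "(real^'r^'m) \<times> (real^'n^'r)"
  obtain X Y where z: "z = (X, Y)" by (cases z)
  obtain e L where e: "0 < e" and L: "L-lipschitz_on (ball (X ** Y) e) g"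
    using assms unfolding locally_Lipschitz_def by blast
  have "((\<lambda>w. fst w ** snd w) \<longlongrightarrow> fst z ** snd z) (nhds z)"
    by (intro tendsto_matrix_mult tendsto_fst tendsto_snd filterlim_ident)
  then have "((\<lambda>w. fst w ** snd w) \<longlongrightarrow> X ** Y) (nhds z)"
    by (simp add: z)
  then have "\<forall>\<^sub>F w in nhds z. fst w ** snd w \<in> ball (X ** Y) e"
    using e by (intro topological_tendstoD) auto
  then obtain \<delta> where \<delta>: "0 < \<delta>" "\<And>w. dist w z < \<delta> \<Longrightarrow> fst w ** snd w \<in> ball (X ** Y) e"
    unfolding eventually_nhds_metric by blast
  define K where "K = norm z + \<delta>"
  have K: "0 \<le> K" using \<delta>(1) by (simp add: K_def)
  have norm_le: "norm (fst w) \<le> K" "norm (snd w) \<le> K" if "w \<in> ball z \<delta>" for w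
  proof -
    have "norm w \<le> K"
      using that norm_triangle_sub[of w z] by (simp add: K_def dist_norm norm_minus_commute)
    then show "norm (fst w) \<le> K" "norm (snd w) \<le> K"
      using norm_fst_le[of "fst w" "snd w"] norm_snd_le[of "snd w" "fst w"] by auto
  qed
  have "(2 * K)-lipschitz_on (ball z \<delta>) (\<lambda>w. fst w ** snd w)"
  proof (rule lipschitz_onI)
    fix v w assume v: "v \<in> ball z \<delta>" and w: "w \<in> ball z \<delta>"
    have fs: "norm (fst v - fst w) \<le> dist v w" "norm (snd v - snd w) \<le> dist v w"
      using dist_fst_le[of v w] dist_snd_le[of v w] by (auto simp: dist_norm)
    have "fst v ** snd v - fst w ** snd w = (fst v - fst w) ** snd v + fst w ** (snd v - snd w)"
      by (simp add: matrix_ring_simps)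
    also have "norm \<dots> \<le> norm (fst v - fst w) * norm (snd v) + norm (fst w) * norm (snd v - snd w)"
      by (intro norm_triangle_mono norm_matrix_mult_le)
    also have "\<dots> \<le> dist v w * K + K * dist v w"
      using norm_le[OF v] norm_le[OF w] fs K by (intro add_mono mult_mono) auto
    finally show "dist (fst v ** snd v) (fst w ** snd w) \<le> 2 * K * dist v w"
      by (simp add: dist_norm)
  qed (use K in simp)
  moreover have "L-lipschitz_on ((\<lambda>w. fst w ** snd w) ` ball z \<delta>) g"
    by (rule lipschitz_on_subset[OF L]) (use \<delta>(2) in \<open>auto simp: dist_commute\<close>)
  ultimately have "(L * (2 * K))-lipschitz_on (ball z \<delta>) (g \<circ> (\<lambda>w. fst w ** snd w))"
    by (rule lipschitz_on_compose)
  then show "\<exists>e>0. \<exists>L. L-lipschitz_on (ball z e) (\<lambda>(X, Y). g (X ** Y))"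
    using \<delta>(1) by (auto simp: o_def case_prod_unfold)
qed

section \<open>From tangent directions to the exponent\<close>

text \<open>
  Testing a Clarke subgradient \<open>\<xi>\<close> with the direction \<open>(V, W)\<close> gives \<open>(g A - g M) / 2 \<le> \<bar>\<xi>\<bar> * C
  * \<bar>A - M\<bar>\<^sup>\<kappa>\<close>, and the growth of \<open>g\<close> bounds \<open>\<bar>A - M\<bar>\<close> by a multiple of \<open>(g A - g M)\<close> to the
  power \<open>1 / \<beta>\<close>.
\<close>

lemma KL_exponent_from_tangent_steps:
  fixes g :: "real^'n^'m \<Rightarrow> real" and M :: "real^'n^'m"
    and Xb :: "real^'r^'m" and Yb :: "real^'n^'r"
  assumes conv: "convex_on UNIV g"
    and factorization: "Xb ** Yb = M"
    and \<beta>: "1 \<le> \<beta>" and \<kappa>: "0 < \<kappa>" "\<kappa> \<le> 1" and a: "0 \<le> a" and c: "0 < c" and C: "0 < C"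
    and growth: "\<forall>\<^sub>F z in nhds (Xb, Yb). c * norm (fst z ** snd z - M) powr \<beta> \<le> g (fst z ** snd z) - g M"
    and subgrad: "\<forall>\<^sub>F z in nhds (Xb, Yb). \<forall>G \<in> convex_subdiff g (fst z ** snd z).
        norm G * (2 * a * (norm (fst z ** snd z - M))\<^sup>2) \<le> (g (fst z ** snd z) - g M) / 2"
    and step: "\<forall>\<^sub>F z in nhds (Xb, Yb). fst z ** snd z \<noteq> M \<longrightarrow>
      (\<exists>V W E. V ** snd z + fst z ** W = M - fst z ** snd z + E \<and>
         norm (V, W) \<le> C * norm (fst z ** snd z - M) powr \<kappa> \<and>
         norm E \<le> 2 * a * (norm (fst z ** snd z - M))\<^sup>2)"
  shows "has_KL_exponent (\<lambda>(X, Y). g (X ** Y)) (1 - \<kappa> / \<beta>) (Xb, Yb)"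
proof -
  let ?f = "\<lambda>(X :: real^'r^'m, Y). g (X ** Y)"
  \<comment> \<open>The factor \<open>2\<close> accounts for the half of \<open>g A - g M\<close> that is lost to the error term.\<close>
  define c' where "c' = c powr (\<kappa> / \<beta>) / (2 * C)"
  have c': "0 < c'" using c C by (simp add: c'_def)
  have \<kappa>\<beta>: "0 < \<kappa> / \<beta>" "\<kappa> / \<beta> \<le> 1" using \<kappa> \<beta> by (auto simp: field_simps)
  have "\<forall>\<^sub>F z in nhds (Xb, Yb). 0 < g (fst z ** snd z) - g M \<longrightarrow>
      c' * (g (fst z ** snd z) - g M) powr (1 - \<kappa> / \<beta>) \<le> infdist 0 (clarke_subdiff ?f z)"
    using growth subgrad step
  proof (eventually_elim, intro impI)
    fix z :: "(real^'r^'m) \<times> (real^'n^'r)"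
    assume growth: "c * norm (fst z ** snd z - M) powr \<beta> \<le> g (fst z ** snd z) - g M"
      and subgrad: "\<forall>G \<in> convex_subdiff g (fst z ** snd z).
        norm G * (2 * a * (norm (fst z ** snd z - M))\<^sup>2) \<le> (g (fst z ** snd z) - g M) / 2"
      and step: "fst z ** snd z \<noteq> M \<longrightarrow>
      (\<exists>V W E. V ** snd z + fst z ** W = M - fst z ** snd z + E \<and>
         norm (V, W) \<le> C * norm (fst z ** snd z - M) powr \<kappa> \<and>
         norm E \<le> 2 * a * (norm (fst z ** snd z - M))\<^sup>2)"
      and pos: "0 < g (fst z ** snd z) - g M"
    obtain X :: "real^'r^'m" and Y where z: "z = (X, Y)" by (cases z)
    define h where "h = g (X ** Y) - g M"
    define e where "e = norm (X ** Y - M)"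
    have h: "0 < h" using pos by (simp add: h_def z)
    then have ne: "X ** Y \<noteq> M" by (auto simp: h_def)
    then have e: "0 < e" by (simp add: e_def)
    obtain V W E where VW: "V ** Y + X ** W = M - X ** Y + E"
      and nVW: "norm (V, W) \<le> C * e powr \<kappa>" and nE: "norm E \<le> 2 * a * e\<^sup>2"
      using step ne by (auto simp: z e_def)
    have e_le: "c powr (\<kappa> / \<beta>) * e powr \<kappa> \<le> h powr (\<kappa> / \<beta>)"
    proof -
      have "(c * e powr \<beta>) powr (\<kappa> / \<beta>) \<le> h powr (\<kappa> / \<beta>)"
        using growth c e \<kappa>\<beta> by (intro powr_mono2) (auto simp: z h_def e_def)
      moreover have "(c * e powr \<beta>) powr (\<kappa> / \<beta>) = c powr (\<kappa> / \<beta>) * e powr \<kappa>"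
        using c e \<beta> by (simp add: powr_mult powr_powr)
      ultimately show ?thesis by simp
    qed
    have "c' * h powr (1 - \<kappa> / \<beta>) \<le> norm \<xi>" if \<xi>: "\<xi> \<in> clarke_subdiff ?f (X, Y)" for \<xi>
    proof -
      obtain G where G: "G \<in> convex_subdiff g (X ** Y)"
        and \<xi>G: "\<And>V W. \<xi> \<bullet> (V, W) = G \<bullet> (V ** Y + X ** W)"
        using clarke_subdiff_factorization[OF conv \<xi>] by metis
      have "g (X ** Y) + G \<bullet> (M - X ** Y) \<le> g M"
        using G by (simp add: convex_subdiff_def)
      then have "h \<le> - (G \<bullet> (M - X ** Y))" by (simp add: h_def)
      also have "\<dots> = G \<bullet> E - \<xi> \<bullet> (V, W)"
        by (simp only: \<xi>G VW inner_add_right)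
      also have "\<dots> \<le> norm G * norm E + norm \<xi> * norm (V, W)"
        using norm_cauchy_schwarz[of G E] norm_cauchy_schwarz[of "- \<xi>" "(V, W)"] by simp
      also have "\<dots> \<le> h / 2 + norm \<xi> * (C * e powr \<kappa>)"
      proof (intro add_mono mult_left_mono nVW)
        have "norm G * norm E \<le> norm G * (2 * a * e\<^sup>2)"
          by (intro mult_left_mono nE) simp
        also have "\<dots> \<le> h / 2" using subgrad G by (simp add: z e_def h_def)
        finally show "norm G * norm E \<le> h / 2" .
      qed simp
      finally have "h \<le> 2 * (norm \<xi> * (C * e powr \<kappa>))" by linarith
      also have "\<dots> = 2 * C * norm \<xi> * e powr \<kappa>" by (simp only: mult_ac)
      finally have "h \<le> 2 * C * norm \<xi> * e powr \<kappa>" .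
      then have "c powr (\<kappa> / \<beta>) * h \<le> c powr (\<kappa> / \<beta>) * (2 * C * norm \<xi> * e powr \<kappa>)"
        by (intro mult_left_mono) simp_all
      also have "\<dots> = 2 * C * norm \<xi> * (c powr (\<kappa> / \<beta>) * e powr \<kappa>)"
        by (simp add: mult_ac)
      also have "\<dots> \<le> 2 * C * norm \<xi> * h powr (\<kappa> / \<beta>)"
        using C by (intro mult_left_mono e_le) simp
      finally have "c powr (\<kappa> / \<beta>) * h \<le> 2 * C * norm \<xi> * h powr (\<kappa> / \<beta>)" .
      then have bound: "c powr (\<kappa> / \<beta>) * h / h powr (\<kappa> / \<beta>) \<le> 2 * C * norm \<xi>"
        using h by (simp add: pos_divide_le_eq)
      have "h powr (1 - \<kappa> / \<beta>) = h / h powr (\<kappa> / \<beta>)"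
        using h by (simp add: powr_diff)
      then have eq: "c' * h powr (1 - \<kappa> / \<beta>) = c powr (\<kappa> / \<beta>) * h / h powr (\<kappa> / \<beta>) / (2 * C)"
        by (simp add: c'_def)
      show ?thesis
        unfolding eq by (subst pos_divide_le_eq) (use bound C in \<open>simp_all add: mult_ac\<close>)
    qed
    then show "c' * (g (fst z ** snd z) - g M) powr (1 - \<kappa> / \<beta>) \<le> infdist 0 (clarke_subdiff ?f z)"
      using clarke_subdiff_factorization_nonempty[OF conv, of X Y]
      by (auto simp: z h_def infdist_def intro!: cINF_greatest)
  qed
  then obtain \<rho> where \<rho>: "0 < \<rho>" and KL: "\<And>z. dist z (Xb, Yb) < \<rho> \<Longrightarrow> 0 < g (fst z ** snd z) - g M \<Longrightarrow>
      c' * (g (fst z ** snd z) - g M) powr (1 - \<kappa> / \<beta>) \<le> infdist 0 (clarke_subdiff ?f z)"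
    unfolding eventually_nhds_metric by blast
  have "\<forall>x\<in>ball (Xb, Yb) \<rho>. 0 < ?f x - ?f (Xb, Yb) \<and> ?f x - ?f (Xb, Yb) < 1 \<longrightarrow>
      c' * (?f x - ?f (Xb, Yb)) powr (1 - \<kappa> / \<beta>) \<le> infdist 0 (clarke_subdiff ?f x)"
    using KL factorization by (auto simp: dist_commute case_prod_unfold)
  moreover have "locally_Lipschitz ?f"
    by (rule locally_Lipschitz_factorization[OF convex_imp_locally_Lipschitz[OF conv]])
  moreover have "0 \<le> 1 - \<kappa> / \<beta>" "1 - \<kappa> / \<beta> < 1" using \<kappa>\<beta> by simp_all
  ultimately show ?thesis
    unfolding has_KL_exponent_def using \<rho> c' zero_less_one by blast
qed

section \<open>Diagonal blocks\<close>

lemma pos_less_CARD: "pos (i :: 'a::{finite,linorder}) < CARD('a)"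
  unfolding pos_def by (rule psubset_card_mono) auto

lemma pos_eq_iff [simp]: "pos i = pos j \<longleftrightarrow> i = j" for i j :: "'a::{finite,linorder}"
proof -
  have "pos a < pos b" if "a < b" for a b :: 'a
    unfolding pos_def by (rule psubset_card_mono) (use that in auto)
  then show ?thesis by (metis less_irrefl linorder_neqE)
qed

lemma pos_surj:
  assumes "k < CARD('a::{finite,linorder})"
  obtains i :: "'a::{finite,linorder}" where "pos i = k"
proof -
  have "range (pos :: 'a \<Rightarrow> nat) = {..<CARD('a)}"
  proof (rule card_subset_eq)
    show "card (range (pos :: 'a \<Rightarrow> nat)) = card {..<CARD('a)}"
      by (subst card_image) (auto simp: inj_on_def)
  qed (auto simp: pos_less_CARD)
  then show ?thesis using assms that by (metis imageE lessThan_iff)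
qed

lemma sum_pos_eq:
  fixes h :: "'a::{finite,linorder} \<Rightarrow> real"
  shows "(\<Sum>i\<in>UNIV. if pos i = k then h i else 0) = (if k < CARD('a) then h (inv pos k) else 0)"
proof (cases "k < CARD('a)")
  case True
  then obtain i :: 'a where i: "pos i = k" using pos_surj by metis
  then have "inv pos k = i" by (metis injI inv_f_f pos_eq_iff)
  moreover have "(pos j = k) = (j = i)" for j using i by auto
  ultimately show ?thesis using True by simp
next
  case False
  then have "pos i \<noteq> k" for i :: 'a using pos_less_CARD[of i] by auto
  then show ?thesis using False by simp
qed

lemma pos_inv_pos: "k < CARD('a) \<Longrightarrow> pos (inv pos k :: 'a::{finite,linorder}) = k"
  by (metis pos_surj f_inv_into_f rangeI)

text \<open>
  The rectangular shape lets \<open>diag_block\<close>, \<open>Xhat\<close>, their pseudoinverses and the coordinate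
  projections all be multiplied by the single rule \<open>rect_diag_mult\<close>.
\<close>

definition rect_diag :: "(nat \<Rightarrow> real) \<Rightarrow> ('m::{finite,linorder}, 'n::{finite,linorder}) rmat" where
  "rect_diag w = (\<chi> i j. if pos i = pos j then w (pos i) else 0)"

lemma diag_block_eq_rect_diag: "diag_block s d = rect_diag (\<lambda>k. if k < s then d k else 0)"
  by (auto simp: diag_block_def rect_diag_def vec_eq_iff)

lemma Xhat_eq_rect_diag: "Xhat s p = rect_diag (\<lambda>k. if k < s + p then 1 else 0)"
  by (auto simp: Xhat_def rect_diag_def vec_eq_iff)

lemma transpose_rect_diag: "transpose (rect_diag w) = rect_diag w"
  by (auto simp: transpose_def rect_diag_def vec_eq_iff)

lemma rect_diag_nth [simp]: "rect_diag w $ i $ j = (if pos i = pos j then w (pos i) else 0)"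
  by (simp add: rect_diag_def)

lemma rect_diag_mult_nth:
  fixes B :: "('k::{finite,linorder}, 'n::{finite,linorder}) rmat"
  shows "((rect_diag w :: ('m::{finite,linorder}, 'k) rmat) ** B) $ i $ j
     = (if pos i < CARD('k) then w (pos i) * B $ inv pos (pos i) $ j else 0)"
proof -
  have "((rect_diag w :: ('m, 'k) rmat) ** B) $ i $ j
          = (\<Sum>k\<in>UNIV. if pos k = pos i then w (pos i) * B $ k $ j else 0)"
    by (auto simp: matrix_matrix_mult_def intro!: sum.cong)
  then show ?thesis by (simp add: sum_pos_eq)
qed

lemma rect_diag_mult:
  assumes "\<And>k. CARD('k) \<le> k \<Longrightarrow> w k * v k = 0"
  shows "(rect_diag w :: ('m::{finite,linorder}, 'k::{finite,linorder}) rmat)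
           ** (rect_diag v :: ('k, 'n::{finite,linorder}) rmat) = rect_diag (\<lambda>k. w k * v k)"
proof -
  have "((rect_diag w :: ('m, 'k) rmat) ** (rect_diag v :: ('k, 'n) rmat)) $ i $ j
          = rect_diag (\<lambda>k. w k * v k) $ i $ j" for i j
    using assms[of "pos i"] by (auto simp: rect_diag_mult_nth pos_inv_pos not_less)
  then show ?thesis by (simp add: vec_eq_iff)
qed

lemma mat_1_eq_rect_diag: "mat 1 = rect_diag (\<lambda>_. 1)"
  by (simp add: mat_def vec_eq_iff)

lemma rect_diag_mult_id_orth_blocks:
  fixes P :: "('k::{finite,linorder}, 'k) rmat"
  assumes P: "P \<in> id_orth_blocks s" and w: "\<And>k. s \<le> k \<Longrightarrow> w k = 0"
  shows "(rect_diag w :: ('m::{finite,linorder}, 'k) rmat) ** P = rect_diag w"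
proof -
  have "((rect_diag w :: ('m, 'k) rmat) ** P) $ i $ j = rect_diag w $ i $ j" for i j
  proof (cases "pos i < CARD('k) \<and> pos i < s")
    case True
    let ?k = "inv pos (pos i) :: 'k"
    have k: "pos ?k = pos i" using True by (simp add: pos_inv_pos)
    then have "P $ ?k $ j = (if ?k = j then 1 else 0)"
      using P True by (simp add: id_orth_blocks_def)
    moreover have "?k = j \<longleftrightarrow> pos i = pos j"
      using k by (metis pos_eq_iff)
    ultimately show ?thesis using True by (simp add: rect_diag_mult_nth)
  next
    case False
    then show ?thesis using w[of "pos i"] pos_less_CARD[of j]
      by (cases "pos i < CARD('k)") (auto simp: rect_diag_mult_nth not_less)
  qed
  then show ?thesis by (simp add: vec_eq_iff)
qed

lemma id_orth_blocks_transpose: "P \<in> id_orth_blocks s \<Longrightarrow> transpose P \<in> id_orth_blocks s"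
  by (simp add: id_orth_blocks_def) (simp add: transpose_def)

lemma id_orth_blocks_mult_rect_diag:
  fixes P :: "('k::{finite,linorder}, 'k) rmat"
  assumes "P \<in> id_orth_blocks s" and "\<And>k. s \<le> k \<Longrightarrow> w k = 0"
  shows "P ** (rect_diag w :: ('k, 'm::{finite,linorder}) rmat) = rect_diag w"
proof -
  have "transpose (P ** (rect_diag w :: ('k, 'm) rmat)) = transpose (rect_diag w)"
    unfolding matrix_transpose_mul transpose_rect_diag
    by (rule rect_diag_mult_id_orth_blocks[OF id_orth_blocks_transpose]) (use assms in auto)
  then show ?thesis by (metis transpose_transpose)
qed

lemma norm_rect_diag_mult_le:
  fixes x :: "(real, 'n::{finite,linorder}) vec"
  assumes "\<And>k. \<bar>w k\<bar> \<le> a"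
  shows "norm ((rect_diag w :: ('m::{finite,linorder}, 'n) rmat) *v x) \<le> a * norm x"
proof -
  have a: "0 \<le> a" using assms[of 0] by linarith
  let ?y = "(rect_diag w :: ('m, 'n) rmat) *v x"
  have y: "?y $ i = (if pos i < CARD('n) then w (pos i) * x $ inv pos (pos i) else 0)" for i
  proof -
    have "?y $ i = (\<Sum>j\<in>UNIV. if pos j = pos i then w (pos i) * x $ j else 0)"
      by (auto simp: matrix_vector_mult_def rect_diag_def intro!: sum.cong)
    then show ?thesis by (simp add: sum_pos_eq)
  qed
  have "(?y $ i)\<^sup>2 \<le> (\<Sum>j\<in>UNIV. if pos j = pos i then a\<^sup>2 * (x $ j)\<^sup>2 else 0)" for i
    using abs_le_square_iff[of "w (pos i)" a] assms[of "pos i"] a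
    by (auto simp: y sum_pos_eq power_mult_distrib intro!: mult_right_mono)
  then have "(\<Sum>i\<in>UNIV. (?y $ i)\<^sup>2) \<le> (\<Sum>i\<in>(UNIV :: 'm set). \<Sum>j\<in>UNIV. if pos j = pos i then a\<^sup>2 * (x $ j)\<^sup>2 else 0)"
    by (rule sum_mono)
  also have "\<dots> = (\<Sum>j\<in>UNIV. \<Sum>i\<in>(UNIV :: 'm set). if pos i = pos j then a\<^sup>2 * (x $ j)\<^sup>2 else 0)"
    by (subst sum.swap) (simp add: eq_commute)
  also have "\<dots> \<le> (\<Sum>j\<in>UNIV. a\<^sup>2 * (x $ j)\<^sup>2)"
    by (intro sum_mono) (simp add: sum_pos_eq)
  also have "\<dots> = (a * norm x)\<^sup>2"
    by (simp add: norm_vec_def L2_set_def power_mult_distrib sum_nonneg sum_distrib_left)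
  finally have "(norm ?y)\<^sup>2 \<le> (a * norm x)\<^sup>2"
    by (simp add: norm_vec_def L2_set_def sum_nonneg)
  then show ?thesis using a by (simp add: power2_le_iff_abs_le)
qed

section \<open>Singular values and the pseudoinverse\<close>

lemma norm_orthogonal_matrix_mult:
  fixes Q :: "real^'n^'n"
  assumes "orthogonal_matrix Q"
  shows "norm (Q *v x) = norm x"
proof -
  have "transpose Q *v (Q *v x) = x"
    using assms by (simp only: orthogonal_matrix_def matrix_vector_mul_assoc matrix_vector_mul_lid)
  then have "(Q *v x) \<bullet> (Q *v x) = x \<bullet> x"
    by (metis dot_lmul_matrix transpose_matrix_vector)
  then show ?thesis by (simp add: norm_eq_sqrt_inner)
qed

lemma orthogonal_matrix_cancel:
  fixes Q :: "real^'n^'n"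
  assumes "orthogonal_matrix Q"
  shows "transpose Q ** (Q ** Z) = Z" "Q ** (transpose Q ** Z) = Z"
  using assms by (simp_all add: orthogonal_matrix_def matrix_mul_assoc)

lemma rect_diag_mult_vec_nth:
  fixes x :: "(real, 'n::{finite,linorder}) vec"
  shows "((rect_diag w :: ('n, 'n) rmat) *v x) $ j = w (pos j) * x $ j"
proof -
  have "((rect_diag w :: ('n, 'n) rmat) *v x) $ j
      = (\<Sum>k\<in>UNIV. (if j = k then w (pos j) else 0) * x $ k)"
    by (simp add: matrix_vector_mult_def)
  also have "\<dots> = (\<Sum>k\<in>UNIV. if k = j then w (pos j) * x $ k else 0)"
    by (rule sum.cong) auto
  finally have "((rect_diag w :: ('n, 'n) rmat) *v x) $ j
      = (\<Sum>k\<in>UNIV. if k = j then w (pos j) * x $ k else 0)" .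
  then show ?thesis by simp
qed

lemma gram_matrix_svd:
  fixes M :: "('m::{finite,linorder}, 'n::{finite,linorder}) rmat"
  assumes svd: "is_svd M s U d V" and "s \<le> CARD('m)"
  shows "transpose M ** M = V ** rect_diag (\<lambda>k. if k < s then (d k)\<^sup>2 else 0) ** transpose V"
proof -
  have M: "M = U ** rect_diag (\<lambda>k. if k < s then d k else 0) ** transpose V"
    and U: "orthogonal_matrix U"
    using svd by (auto simp: is_svd_def diag_block_eq_rect_diag)
  let ?D = "rect_diag (\<lambda>k. if k < s then d k else 0)"
  have D: "(?D :: ('n, 'm) rmat) ** (?D :: ('m, 'n) rmat) = rect_diag (\<lambda>k. if k < s then (d k)\<^sup>2 else 0)"
    using assms(2) by (subst rect_diag_mult)
      (auto intro!: arg_cong[where f = rect_diag] simp: fun_eq_iff power2_eq_square)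
  have "transpose M ** M = V ** ((?D :: ('n, 'm) rmat) ** (?D :: ('m, 'n) rmat)) ** transpose V"
    unfolding M by (simp add: matrix_transpose_mul transpose_rect_diag orthogonal_matrix_cancel[OF U]
        flip: matrix_mul_assoc)
  then show ?thesis by (simp add: D)
qed

text \<open>
  In the basis of right singular vectors the Gram matrix is diagonal, and its eigenspace for a
  positive eigenvalue is spanned by coordinate vectors.
\<close>

lemma gram_eigenspace_svd:
  fixes M :: "('m::{finite,linorder}, 'n::{finite,linorder}) rmat"
  assumes svd: "is_svd M s U d V" and s: "s \<le> CARD('m)" and t: "0 < t"
  shows "gram_eigenspace M (t\<^sup>2) = (*v) V ` {w. \<forall>j. j \<notin> {j. pos j < s \<and> d (pos j) = t} \<longrightarrow> w $ j = 0}"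
    (is "?E = (*v) V ` ?W")
proof -
  let ?D = "rect_diag (\<lambda>k. if k < s then (d k)\<^sup>2 else 0) :: ('n, 'n) rmat"
  have V: "orthogonal_matrix V" and d: "\<And>k. k < s \<Longrightarrow> 0 < d k"
    using svd by (auto simp: is_svd_def)
  have VV: "transpose V *v (V *v w) = w" "V *v (transpose V *v w) = w" for w
    using V by (simp_all only: orthogonal_matrix_def matrix_vector_mul_assoc matrix_vector_mul_lid)
  have V_inj: "V *v v = V *v w \<longleftrightarrow> v = w" for v w
    by (metis VV(1))
  have W: "w \<in> ?W \<longleftrightarrow> ?D *v w = t\<^sup>2 *\<^sub>R w" for w
  proof -
    have "(if pos j < s then (d (pos j))\<^sup>2 else 0) * w $ j = t\<^sup>2 * w $ j \<longleftrightarrow>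
        (j \<notin> {j. pos j < s \<and> d (pos j) = t} \<longrightarrow> w $ j = 0)" for j
      using d[of "pos j"] t by (auto simp: power2_eq_iff_nonneg less_imp_le)
    then show ?thesis
      by (simp add: vec_eq_iff rect_diag_mult_vec_nth)
  qed
  have E: "v \<in> ?E \<longleftrightarrow> transpose V *v v \<in> ?W" for v
  proof -
    have "(transpose M ** M) *v v = V *v (?D *v (transpose V *v v))"
      by (simp only: gram_matrix_svd[OF svd s] matrix_vector_mul_assoc matrix_mul_assoc)
    moreover have "t\<^sup>2 *\<^sub>R v = V *v (t\<^sup>2 *\<^sub>R (transpose V *v v))"
      by (simp only: matrix_vector_mult_scaleR VV)
    ultimately have "v \<in> ?E \<longleftrightarrow> V *v (?D *v (transpose V *v v)) = V *v (t\<^sup>2 *\<^sub>R (transpose V *v v))"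
      by (simp add: gram_eigenspace_def)
    also have "\<dots> \<longleftrightarrow> ?D *v (transpose V *v v) = t\<^sup>2 *\<^sub>R (transpose V *v v)"
      by (rule V_inj)
    finally show ?thesis unfolding W .
  qed
  show ?thesis
  proof (rule set_eqI)
    fix v
    have img: "v \<in> (*v) V ` X \<longleftrightarrow> transpose V *v v \<in> X" for X
    proof
      assume "v \<in> (*v) V ` X"
      then show "transpose V *v v \<in> X" by (elim imageE) (simp only: VV)
    next
      assume "transpose V *v v \<in> X"
      then show "v \<in> (*v) V ` X" by (rule_tac image_eqI[where x = "transpose V *v v"]) (simp only: VV, assumption)
    qed
    show "v \<in> ?E \<longleftrightarrow> v \<in> (*v) V ` ?W"
      by (rule trans[OF E img[symmetric]])
  qed
qed

lemma dim_gram_eigenspace_svd: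
  fixes M :: "('m::{finite,linorder}, 'n::{finite,linorder}) rmat"
  assumes svd: "is_svd M s U d V" and s: "s \<le> CARD('m)" and t: "0 < t"
  shows "dim (gram_eigenspace M (t\<^sup>2)) = card {j :: 'n. pos j < s \<and> d (pos j) = t}"
proof -
  have V: "orthogonal_matrix V" using svd by (simp add: is_svd_def)
  have "inj ((*v) V)"
    by (rule injI) (metis V matrix_vector_mul_assoc matrix_vector_mul_lid orthogonal_matrix_def)
  then have "dim (gram_eigenspace M (t\<^sup>2)) = dim {w :: (real, 'n) vec. \<forall>j. j \<notin> {j. pos j < s \<and> d (pos j) = t} \<longrightarrow> w $ j = 0}"
    unfolding gram_eigenspace_svd[OF assms]
    by (intro dim_image_eq) (auto intro: inj_on_subset)
  then show ?thesis by (simp only: dim_vec_eq[symmetric] dim_substandard_cart)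
qed

lemma singular_values_svd:
  fixes M :: "('m::{finite,linorder}, 'n::{finite,linorder}) rmat"
  assumes svd: "is_svd M s U d V" and s: "s \<le> CARD('m)" and t: "0 < t"
  shows "t \<in> singular_values M \<longleftrightarrow> {j :: 'n. pos j < s \<and> d (pos j) = t} \<noteq> {}"
proof -
  have "t \<in> singular_values M \<longleftrightarrow> \<not> gram_eigenspace M (t\<^sup>2) \<subseteq> {0}"
    using t by (auto simp: singular_values_def)
  also have "\<dots> \<longleftrightarrow> dim (gram_eigenspace M (t\<^sup>2)) \<noteq> 0"
    by (simp only: dim_eq_0)
  finally show ?thesis by (simp add: dim_gram_eigenspace_svd[OF assms])
qed

lemma card_pos_less:
  assumes "s \<le> CARD('n::{finite,linorder})"
  shows "card {j :: 'n::{finite,linorder}. pos j < s} = s"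
proof -
  have "bij_betw pos {j :: 'n. pos j < s} {..<s}"
  proof (rule bij_betwI')
    fix k assume "k \<in> {..<s}"
    then obtain j :: 'n where "pos j = k" using assms pos_surj by (metis lessThan_iff order_less_le_trans)
    then show "\<exists>j\<in>{j :: 'n. pos j < s}. k = pos j" using \<open>k \<in> {..<s}\<close> by auto
  qed auto
  then show ?thesis by (simp add: bij_betw_same_card)
qed

text \<open>
  For \<open>\<sigma> > 0\<close> the multiplicities of the singular values \<open>\<ge> \<sigma>\<close> add up to the number of entries \<open>d
  k \<ge> \<sigma>\<close>. All \<open>s\<close> entries are counted only if \<open>\<sigma>\<close> is at most the smallest of them. That smallest
  entry also shows that the set whose maximum defines the \<open>s\<close>-th singular value is not empty,
  without which this maximum would say nothing.
\<close>

lemma nth_singular_value_svd_le: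
  fixes M :: "('m::{finite,linorder}, 'n::{finite,linorder}) rmat"
  assumes svd: "is_svd M s U d V" and s: "s \<le> CARD('m)" "s \<le> CARD('n)" and "s \<noteq> 0"
  obtains \<sigma> where "nth_singular_value s M = ereal \<sigma>" and "\<And>k. k < s \<Longrightarrow> \<sigma> \<le> d k"
proof -
  have d: "\<And>k. k < s \<Longrightarrow> 0 < d k" using svd by (auto simp: is_svd_def)
  let ?I = "\<lambda>t. {j :: 'n. pos j < s \<and> d (pos j) = t}"
  define S where "S = {\<sigma> \<in> singular_values M.
      s \<le> (\<Sum>\<tau> \<in> {\<tau> \<in> singular_values M. \<sigma> \<le> \<tau>}. dim (gram_eigenspace M (\<tau>\<^sup>2)))}"
  have sv: "singular_values M \<subseteq> insert 0 (d ` {..<s})"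
  proof
    fix t assume t: "t \<in> singular_values M"
    show "t \<in> insert 0 (d ` {..<s})"
    proof (cases "t = 0")
      case False
      then have "0 < t" using t by (auto simp: singular_values_def)
      then show ?thesis using singular_values_svd[OF svd s(1), of t] t by auto
    qed simp
  qed
  have fin: "finite (singular_values M)"
    by (rule finite_subset[OF sv]) simp
  have count: "(\<Sum>\<tau> \<in> {\<tau> \<in> singular_values M. \<sigma> \<le> \<tau>}. dim (gram_eigenspace M (\<tau>\<^sup>2)))
      = card {j :: 'n. pos j < s \<and> \<sigma> \<le> d (pos j)}" if "0 < \<sigma>" for \<sigma>
  proof -
    have "(\<Sum>\<tau> \<in> {\<tau> \<in> singular_values M. \<sigma> \<le> \<tau>}. dim (gram_eigenspace M (\<tau>\<^sup>2)))
        = (\<Sum>\<tau> \<in> {\<tau> \<in> singular_values M. \<sigma> \<le> \<tau>}. card (?I \<tau>))"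
      using that by (intro sum.cong refl dim_gram_eigenspace_svd[OF svd s(1)]) auto
    also have "\<dots> = card (\<Union>\<tau> \<in> {\<tau> \<in> singular_values M. \<sigma> \<le> \<tau>}. ?I \<tau>)"
      using fin by (intro card_UN_disjoint[symmetric]) auto
    also have "(\<Union>\<tau> \<in> {\<tau> \<in> singular_values M. \<sigma> \<le> \<tau>}. ?I \<tau>) = {j :: 'n. pos j < s \<and> \<sigma> \<le> d (pos j)}"
    proof -
      have "d (pos j) \<in> singular_values M" if "pos j < s" for j :: 'n
        using singular_values_svd[OF svd s(1) d[OF that]] that by auto
      then show ?thesis by auto
    qed
    finally show ?thesis .
  qed
  define m where "m = Min (d ` {..<s})"
  have "m \<in> d ` {..<s}"
    unfolding m_def by (rule Min_in) (use \<open>s \<noteq> 0\<close> in auto)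
  then obtain k where k: "k < s" "m = d k" by auto
  have m_le: "m \<le> d i" if "i < s" for i
    unfolding m_def by (rule Min_le) (use that in auto)
  have m: "0 < m" using k d by simp
  obtain j :: 'n where "pos j = k" using pos_surj k(1) s(2) by (metis order_less_le_trans)
  then have "m \<in> singular_values M"
    using singular_values_svd[OF svd s(1) m] k by auto
  moreover have "{j :: 'n. pos j < s \<and> m \<le> d (pos j)} = {j. pos j < s}"
    using m_le by auto
  ultimately have "m \<in> S"
    using count[OF m] card_pos_less[OF s(2)] by (simp add: S_def)
  have finS: "finite S" using fin by (simp add: S_def)
  have S_le: "\<sigma> \<le> d i" if \<sigma>: "\<sigma> \<in> S" and i: "i < s" for \<sigma> i
  proof (rule ccontr)
    assume "\<not> \<sigma> \<le> d i"
    then have gt: "d i < \<sigma>" by simp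
    then have pos\<sigma>: "0 < \<sigma>" using d[OF i] by simp
    obtain j0 :: 'n where j0: "pos j0 = i" using pos_surj i s(2) by (metis order_less_le_trans)
    have "{j :: 'n. pos j < s \<and> \<sigma> \<le> d (pos j)} \<subset> {j. pos j < s}"
      using gt i j0 by force
    then have "card {j :: 'n. pos j < s \<and> \<sigma> \<le> d (pos j)} < s"
      using psubset_card_mono[OF finite] card_pos_less[OF s(2)] by metis
    then show False using \<sigma> count[OF pos\<sigma>] by (simp add: S_def)
  qed
  have "nth_singular_value s M = ereal (Max S)"
    using \<open>s \<noteq> 0\<close> by (simp add: nth_singular_value_def S_def)
  moreover have "Max S \<in> S"
    using finS \<open>m \<in> S\<close> by (intro Max_in) auto
  ultimately show ?thesis using that S_le by blast
qed

lemma
  fixes M :: "('m::{finite,linorder}, 'n::{finite,linorder}) rmat"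
    and U :: "('m, 'm) rmat" and V :: "('n, 'n) rmat" and d :: "nat \<Rightarrow> real" and s :: nat
  defines "Mp \<equiv> V ** rect_diag (\<lambda>k. if k < s then 1 / d k else 0) ** transpose U"
  assumes svd: "is_svd M s U d V" and s: "s \<le> CARD('m)" "s \<le> CARD('n)"
  shows svd_pseudoinverse_inner: "M ** Mp ** M = M"
    and svd_pseudoinverse_sym: "transpose (M ** Mp) = M ** Mp"
    and norm_svd_pseudoinverse_le:
      "\<lbrakk>\<And>k. k < s \<Longrightarrow> 1 / d k \<le> a; 0 \<le> a\<rbrakk> \<Longrightarrow> norm (transpose Mp *v x) \<le> a * norm x"
proof -
  have M: "M = U ** rect_diag (\<lambda>k. if k < s then d k else 0) ** transpose V"
    and U: "orthogonal_matrix U" and V: "orthogonal_matrix V" and d: "\<And>k. k < s \<Longrightarrow> 0 < d k"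
    using svd by (auto simp: is_svd_def diag_block_eq_rect_diag)
  let ?I = "rect_diag (\<lambda>k. if k < s then 1 else 0) :: ('m, 'm) rmat"
  let ?D = "rect_diag (\<lambda>k. if k < s then d k else 0) :: ('m, 'n) rmat"
  have DD: "?D ** (rect_diag (\<lambda>k. if k < s then 1 / d k else 0) :: ('n, 'm) rmat) = ?I"
    using s d[THEN less_imp_neq] by (subst rect_diag_mult)
      (auto intro!: arg_cong[where f = rect_diag] simp: fun_eq_iff)
  have ID: "?I ** ?D = ?D"
    using s by (subst rect_diag_mult) (auto intro!: arg_cong[where f = rect_diag])
  have MMp: "M ** Mp = U ** ?I ** transpose U"
    unfolding M Mp_def DD[symmetric]
    by (simp add: orthogonal_matrix_cancel[OF V] flip: matrix_mul_assoc)
  have "M ** Mp ** M = U ** (?I ** ?D) ** transpose V"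
    unfolding MMp unfolding M by (simp add: orthogonal_matrix_cancel[OF U] flip: matrix_mul_assoc)
  then show "M ** Mp ** M = M"
    unfolding ID using M by simp
  show "transpose (M ** Mp) = M ** Mp"
    unfolding MMp by (simp add: matrix_transpose_mul transpose_rect_diag flip: matrix_mul_assoc)
  assume a: "\<And>k. k < s \<Longrightarrow> 1 / d k \<le> a" "0 \<le> a"
  have "transpose Mp = U ** rect_diag (\<lambda>k. if k < s then 1 / d k else 0) ** transpose V"
    by (simp add: Mp_def matrix_transpose_mul transpose_rect_diag flip: matrix_mul_assoc)
  then have "transpose Mp *v x = U *v (rect_diag (\<lambda>k. if k < s then 1 / d k else 0) *v (transpose V *v x))"
    by (simp only: matrix_vector_mul_assoc matrix_mul_assoc)
  moreover have "norm ((rect_diag (\<lambda>k. if k < s then 1 / d k else 0) :: ('m, 'n) rmat) *v (transpose V *v x))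
      \<le> a * norm (transpose V *v x)"
    by (rule norm_rect_diag_mult_le) (use a d in \<open>auto simp: less_imp_le\<close>)
  moreover have "norm (transpose V *v x) = norm x"
    by (rule norm_orthogonal_matrix_mult) (use V in simp)
  ultimately show "norm (transpose Mp *v x) \<le> a * norm x"
    by (simp add: norm_orthogonal_matrix_mult[OF U] del: transpose_matrix_vector)
qed

section \<open>The sets of factorizations\<close>

lemma mult_rect_diag_nth:
  fixes B :: "('m::{finite,linorder}, 'k::{finite,linorder}) rmat"
  shows "(B ** (rect_diag w :: ('k, 'n::{finite,linorder}) rmat)) $ i $ j
     = (if pos j < CARD('k) then B $ i $ inv pos (pos j) * w (pos j) else 0)"
proof -
  have "(B ** (rect_diag w :: ('k, 'n) rmat)) $ i $ j
          = (\<Sum>k\<in>UNIV. if pos k = pos j then B $ i $ k * w (pos j) else 0)"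
    by (auto simp: matrix_matrix_mult_def intro!: sum.cong)
  then show ?thesis by (simp add: sum_pos_eq)
qed

lemma Xhat_mult_Yhat:
  assumes "s + p \<le> CARD('r)"
  shows "(Xhat s p :: ('m::{finite,linorder}, 'r::{finite,linorder}) rmat) ** Yhat s d p q
     = (diag_block s d :: ('m, 'n::{finite,linorder}) rmat)"
proof -
  have "((Xhat s p :: ('m, 'r) rmat) ** Yhat s d p q) $ i $ j = (diag_block s d :: ('m, 'n) rmat) $ i $ j" for i j
    using assms by (auto simp: Xhat_eq_rect_diag rect_diag_mult_nth Yhat_def diag_block_def pos_inv_pos)
  then show ?thesis by (simp add: vec_eq_iff)
qed

lemma Yhat_mult_reciprocal_diag:
  assumes "\<And>k. k < s \<Longrightarrow> d k \<noteq> 0" "s \<le> CARD('n)"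
  shows "Yhat s d p q ** (rect_diag (\<lambda>k. if k < s then 1 / d k else 0) :: ('n::{finite,linorder}, 'm::{finite,linorder}) rmat)
     = (rect_diag (\<lambda>k. if k < s then 1 else 0) :: ('r::{finite,linorder}, 'm) rmat)"
proof -
  have "(Yhat s d p q ** (rect_diag (\<lambda>k. if k < s then 1 / d k else 0) :: ('n, 'm) rmat)) $ i $ j
     = (rect_diag (\<lambda>k. if k < s then 1 else 0) :: ('r, 'm) rmat) $ i $ j" for i j
    using assms by (auto simp: mult_rect_diag_nth Yhat_def pos_inv_pos)
  then show ?thesis by (simp add: vec_eq_iff)
qed

text \<open>
  The pseudoinverse of \<open>Yhat\<close>. Its columns in the third block are shifted back by \<open>p\<close>, the
  offset between the third row block and the second column block of \<open>Yhat\<close>.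
\<close>

definition Yhat_right_inverse ::
  "nat \<Rightarrow> (nat \<Rightarrow> real) \<Rightarrow> nat \<Rightarrow> nat \<Rightarrow> ('n::{finite,linorder}, 'r::{finite,linorder}) rmat" where
  "Yhat_right_inverse s d p q = (\<chi> j k.
     if pos j = (if pos k < s then pos k else pos k - p)
     then (if pos k < s then 1 / d (pos k) else if s + p \<le> pos k \<and> pos k < s + p + q then 1 else 0)
     else 0)"

lemma Yhat_mult_right_inverse:
  assumes d: "\<And>k. k < s \<Longrightarrow> d k \<noteq> 0" and sq: "s + q \<le> CARD('n)"
  shows "(Yhat s d p q :: ('r::{finite,linorder}, 'n::{finite,linorder}) rmat) ** Yhat_right_inverse s d p q
     = (rect_diag (\<lambda>k. if k < s \<or> s + p \<le> k \<and> k < s + p + q then 1 else 0) :: ('r, 'r) rmat)"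
proof -
  let ?Y = "Yhat s d p q :: ('r, 'n) rmat"
  have "(?Y ** Yhat_right_inverse s d p q) $ i $ k
      = (rect_diag (\<lambda>k. if k < s \<or> s + p \<le> k \<and> k < s + p + q then 1 else 0) :: ('r, 'r) rmat) $ i $ k" for i k
  proof -
    define c where "c = (if pos k < s then pos k else pos k - p)"
    define w where "w = (if pos k < s then 1 / d (pos k) else if s + p \<le> pos k \<and> pos k < s + p + q then 1 else 0)"
    have "(?Y ** Yhat_right_inverse s d p q) $ i $ k
        = (\<Sum>j\<in>UNIV. ?Y $ i $ j * (if pos j = c then w else 0))"
      by (simp only: matrix_matrix_mult_def Yhat_right_inverse_def c_def w_def vec_lambda_beta)
    also have "\<dots> = (\<Sum>j\<in>UNIV. if pos j = c then ?Y $ i $ j * w else 0)"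
      by (rule sum.cong) auto
    also have "\<dots> = (if c < CARD('n) then ?Y $ i $ inv pos c * w else 0)"
      by (rule sum_pos_eq)
    also have "\<dots> = (rect_diag (\<lambda>k. if k < s \<or> s + p \<le> k \<and> k < s + p + q then 1 else 0) :: ('r, 'r) rmat) $ i $ k"
    proof (cases "pos k < s")
      case True
      then show ?thesis
        using d[OF True] sq by (auto simp: c_def w_def Yhat_def pos_inv_pos)
    next
      case False
      then show ?thesis
        using sq by (auto simp: c_def w_def Yhat_def pos_inv_pos)
    qed
    finally show ?thesis .
  qed
  then show ?thesis by (simp add: vec_eq_iff)
qed

text \<open>
  Up to changes of basis, \<open>Yb ** Mp ** Xb\<close> is the projection onto the first block of the inner
  space, \<open>Xb\<close> has a left inverse on the second block, the range of \<open>J\<close>, and \<open>Yb\<close> a right inverse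
  over the first and third. For \<open>p + q = r - s\<close> there is no fourth block, so that these blocks
  exhaust the space.
\<close>

lemma
  fixes M :: "('m::{finite,linorder}, 'n::{finite,linorder}) rmat"
    and Xb :: "('m, 'r::{finite,linorder}) rmat" and Yb :: "('r, 'n) rmat"
    and U :: "('m, 'm) rmat" and V :: "('n, 'n) rmat" and d :: "nat \<Rightarrow> real" and s :: nat
  defines "Mp \<equiv> V ** rect_diag (\<lambda>k. if k < s then 1 / d k else 0) ** transpose U"
  assumes svd: "is_svd M s U d V"
    and dims: "s + p \<le> CARD('m)" "s + q \<le> CARD('n)" "s + p + q \<le> CARD('r)"
    and mem: "(Xb, Yb) \<in> O_set U d V s p q"
  shows O_set_factorization: "Xb ** Yb = M"
    and O_set_complementary_inverses: "p + q = CARD('r) - s \<Longrightarrow>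
      \<exists>(N' :: ('r, 'm) rmat) (N :: ('n, 'r) rmat) J.
        J ** J = J \<and> N' ** Xb ** (mat 1 - Yb ** Mp ** Xb) = J \<and> Yb ** N + J = mat 1"
proof -
  have M: "M = U ** diag_block s d ** transpose V"
    and U: "orthogonal_matrix U" and V: "orthogonal_matrix V" and d: "\<And>k. k < s \<Longrightarrow> d k \<noteq> 0"
    using svd by (auto simp: is_svd_def less_imp_neq)
  obtain P R and A :: "('r, 'r) rmat" where P: "P \<in> id_orth_blocks s" and A: "invertible A" and R: "R \<in> id_orth_blocks s"
    and Xb: "Xb = U ** transpose P ** Xhat s p ** A"
    and Yb: "Yb = matrix_inv A ** Yhat s d p q ** R ** transpose V"
    using mem unfolding O_set_def by blast
  have PO: "orthogonal_matrix P" and RO: "orthogonal_matrix R"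
    using P R by (auto simp: id_orth_blocks_def)
  note cancel = orthogonal_matrix_cancel[OF U] orthogonal_matrix_cancel[OF V]
    orthogonal_matrix_cancel[OF PO] orthogonal_matrix_cancel[OF RO] matrix_inv_cancel[OF A]
  have "Xb ** Yb = U ** (transpose P ** ((Xhat s p :: ('m, 'r) rmat) ** Yhat s d p q) ** R) ** transpose V"
    unfolding Xb Yb by (simp add: cancel flip: matrix_mul_assoc)
  also have "transpose P ** ((Xhat s p :: ('m, 'r) rmat) ** Yhat s d p q) ** R = diag_block s d"
    using dims by (simp add: Xhat_mult_Yhat diag_block_eq_rect_diag rect_diag_mult_id_orth_blocks[OF R]
        id_orth_blocks_mult_rect_diag[OF id_orth_blocks_transpose[OF P]])
  finally show "Xb ** Yb = M" by (simp add: M)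
  assume pq: "p + q = CARD('r) - s"
  define J1 where "J1 = (rect_diag (\<lambda>k. if k < s then 1 else 0) :: ('r, 'r) rmat)"
  define J2 where "J2 = (rect_diag (\<lambda>k. if s \<le> k \<and> k < s + p then 1 else 0) :: ('r, 'r) rmat)"
  let ?D = "rect_diag (\<lambda>k. if k < s then 1 / d k else 0) :: ('n, 'm) rmat"
  have "Yb ** Mp ** Xb = matrix_inv A ** ((Yhat s d p q ** (R ** ?D ** transpose P)) ** Xhat s p) ** A"
    unfolding Xb Yb Mp_def by (simp add: cancel flip: matrix_mul_assoc)
  also have "R ** ?D ** transpose P = ?D"
    by (simp add: rect_diag_mult_id_orth_blocks[OF id_orth_blocks_transpose[OF P]]
        id_orth_blocks_mult_rect_diag[OF R])
  also have "Yhat s d p q ** ?D = (rect_diag (\<lambda>k. if k < s then 1 else 0) :: ('r, 'm) rmat)"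
    by (rule Yhat_mult_reciprocal_diag) (use d dims in auto)
  also have "\<dots> ** Xhat s p = J1"
    unfolding Xhat_eq_rect_diag J1_def using dims
    by (subst rect_diag_mult) (auto intro!: arg_cong[where f = rect_diag])
  finally have YMX: "Yb ** Mp ** Xb = matrix_inv A ** J1 ** A" .
  have J2J1: "J2 ** J1 = 0" and J2J2: "J2 ** J2 = J2"
    unfolding J1_def J2_def using dims
    by (subst rect_diag_mult; auto simp: vec_eq_iff)+
  have J2X: "J2 ** (Xhat s p :: ('r, 'm) rmat) ** (Xhat s p :: ('m, 'r) rmat) = J2"
    unfolding J2_def Xhat_eq_rect_diag using dims
    by (subst rect_diag_mult, simp, subst rect_diag_mult) (auto simp: vec_eq_iff)
  define J where "J = matrix_inv A ** J2 ** A"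
  define N' where "N' = matrix_inv A ** J2 ** (Xhat s p :: ('r, 'm) rmat) ** P ** transpose U"
  define N where "N = V ** transpose R ** Yhat_right_inverse s d p q ** A"
  have "J ** J = matrix_inv A ** (J2 ** J2) ** A"
    unfolding J_def by (simp add: cancel flip: matrix_mul_assoc)
  then have JJ: "J ** J = J" by (simp add: J2J2 J_def)
  have "N' ** Xb = matrix_inv A ** (J2 ** (Xhat s p :: ('r, 'm) rmat) ** (Xhat s p :: ('m, 'r) rmat)) ** A"
    unfolding N'_def Xb by (simp add: cancel flip: matrix_mul_assoc)
  then have N'X: "N' ** Xb = J" unfolding J2X J_def .
  have "J ** (matrix_inv A ** J1 ** A) = matrix_inv A ** (J2 ** J1) ** A"
    unfolding J_def by (simp add: cancel flip: matrix_mul_assoc)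
  then have N'XT: "N' ** Xb ** (mat 1 - Yb ** Mp ** Xb) = J"
    unfolding N'X YMX matrix_mult_diff_right J2J1
    by (simp add: matrix_mult_zero_left matrix_mult_zero_right)
  have YYi: "(Yhat s d p q :: ('r, 'n) rmat) ** Yhat_right_inverse s d p q = mat 1 - J2"
  proof -
    have less: "pos k < s + p + q" for k :: 'r
      using pos_less_CARD[of k] pq dims by linarith
    have "(rect_diag (\<lambda>k. if k < s \<or> s + p \<le> k \<and> k < s + p + q then 1 else 0) :: ('r, 'r) rmat) $ i $ k
        = (mat 1 - J2) $ i $ k" for i k
      using less[of i] by (cases "i = k") (auto simp: J2_def mat_1_eq_rect_diag)
    then show ?thesis
      by (simp add: Yhat_mult_right_inverse[OF d dims(2)] vec_eq_iff)
  qed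
  have "Yb ** N = matrix_inv A ** (mat 1 - J2) ** A"
    unfolding Yb N_def YYi[symmetric] by (simp add: cancel flip: matrix_mul_assoc)
  then have "Yb ** N + J = mat 1"
    by (simp add: J_def matrix_mult_diff_left matrix_mult_diff_right matrix_inv_cancel[OF A])
  then show "\<exists>(N' :: ('r, 'm) rmat) (N :: ('n, 'r) rmat) J.
        J ** J = J \<and> N' ** Xb ** (mat 1 - Yb ** Mp ** Xb) = J \<and> Yb ** N + J = mat 1"
    using JJ N'XT by blast
qed

section \<open>The exponents at the global minima\<close>

theorem theorem4p24:
  fixes M :: "('m::{finite,linorder}, 'n::{finite,linorder}) rmat"
    and g :: "('m, 'n) rmat \<Rightarrow> real"
    and f :: "('m, 'r::{finite,linorder}) rmat \<times> ('r, 'n) rmat \<Rightarrow> real"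
    and \<beta> :: real and s :: nat
    and U :: "('m, 'm) rmat" and d :: "nat \<Rightarrow> real" and V :: "('n, 'n) rmat"
    and Xb :: "('m, 'r) rmat" and Yb :: "('r, 'n) rmat"
  assumes rank_M: "rank M = s" "s \<le> CARD('r)"
    and svd: "is_svd M s U d V"
    and A1: "convex_on UNIV g"
    and A2: "\<forall>A. A \<noteq> M \<longrightarrow> g M < g A"
    and A3: "\<exists>c>0. \<exists>\<delta>>0.
      (\<forall>A \<in> ball M \<delta>. rank A \<le> CARD('r) \<longrightarrow> g A \<ge> g M + c * norm (A - M) powr \<beta>) \<and>
      ((1 \<le> \<beta> \<and> \<beta> < 2) \<or>
       (\<beta> = 2 \<and>
        (\<forall>A \<in> ball M \<delta>. rank A \<le> CARD('r) \<longrightarrow>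
          (SUP G \<in> convex_subdiff g A. ereal (norm G)) \<le> nth_singular_value s M * ereal c / 8)))"
    and f_def: "f = (\<lambda>(X, Y). g (X ** Y))"
    and glob_min: "\<forall>X Y. f (Xb, Yb) \<le> f (X, Y)"
  shows "(\<forall>p q. s + p \<le> CARD('m) \<and> s + q \<le> CARD('n) \<and> s + p + q \<le> CARD('r) \<and>
              (Xb, Yb) \<in> O_set U d V s p q \<and> p + q = CARD('r) - s \<longrightarrow>
            has_KL_exponent f (1 - 1 / \<beta>) (Xb, Yb)) \<and>
         (\<forall>p q. s + p \<le> CARD('m) \<and> s + q \<le> CARD('n) \<and> s + p + q \<le> CARD('r) \<and>
              (Xb, Yb) \<in> O_set U d V s p q \<and> p + q < CARD('r) - s \<longrightarrow>
            has_KL_exponent f (1 - 1 / (2 * \<beta>)) (Xb, Yb))"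
proof -
  obtain c \<delta> where c: "0 < c" and \<delta>: "0 < \<delta>"
    and growth: "\<And>A. A \<in> ball M \<delta> \<Longrightarrow> rank A \<le> CARD('r) \<Longrightarrow> g M + c * norm (A - M) powr \<beta> \<le> g A"
    and cases: "(1 \<le> \<beta> \<and> \<beta> < 2) \<or> (\<beta> = 2 \<and> (\<forall>A \<in> ball M \<delta>. rank A \<le> CARD('r) \<longrightarrow>
          (SUP G \<in> convex_subdiff g A. ereal (norm G)) \<le> nth_singular_value s M * ereal c / 8))"
    using A3 by blast
  have d: "\<And>k. k < s \<Longrightarrow> 0 < d k" using svd by (simp add: is_svd_def)
  have \<beta>: "1 \<le> \<beta>" using cases by auto
  have KL: "has_KL_exponent f (1 - \<kappa> / \<beta>) (Xb, Yb)"
    if dims: "s + p \<le> CARD('m)" "s + q \<le> CARD('n)" "s + p + q \<le> CARD('r)"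
      and mem: "(Xb, Yb) \<in> O_set U d V s p q"
      and \<kappa>: "\<kappa> = 1 / 2 \<or> \<kappa> = 1 \<and> p + q = CARD('r) - s" for p q \<kappa>
  proof -
    have s: "s \<le> CARD('m)" "s \<le> CARD('n)" using dims by auto
    define Mp where "Mp = V ** rect_diag (\<lambda>k. if k < s then 1 / d k else 0) ** transpose U"
    \<comment> \<open>The operator norm of the pseudoinverse; for \<open>M = 0\<close> it is \<open>0\<close>, and so is the error term.\<close>
    define a where "a = (if s = 0 then 0 else Max ((\<lambda>k. 1 / d k) ` {..<s}))"
    have a_upper: "1 / d k \<le> a" if "k < s" for k
      using that by (auto simp: a_def intro!: Max_ge)
    have a_attained: "\<exists>k<s. a = 1 / d k" if "s \<noteq> 0"
    proof -
      have "Max ((\<lambda>k. 1 / d k) ` {..<s}) \<in> (\<lambda>k. 1 / d k) ` {..<s}"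
        by (rule Max_in) (use that in auto)
      then show ?thesis using that by (auto simp: a_def)
    qed
    have a_nonneg: "0 \<le> a"
      using a_attained d by (cases "s = 0") (auto simp: a_def less_imp_le)
    interpret factorization_point M Mp a Xb Yb
      unfolding Mp_def
      by unfold_locales
        (use svd_pseudoinverse_inner[OF svd s] svd_pseudoinverse_sym[OF svd s]
          norm_svd_pseudoinverse_le[OF svd s a_upper a_nonneg] a_nonneg O_set_factorization[OF svd dims mem] in simp_all)
    have "splits_with_exponent \<kappa>"
      using \<kappa> splits_with_exponent_half splits_with_exponent_one
        O_set_complementary_inverses[OF svd dims mem] unfolding Mp_def by blast
    moreover have \<kappa>01: "0 < \<kappa>" "\<kappa> \<le> 1" using \<kappa> by auto
    ultimately obtain C where C: "0 < C" and step: "\<forall>\<^sub>F z in near. prd z \<noteq> M \<longrightarrow>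
        (\<exists>V W E. V ** snd z + fst z ** W = M - prd z + E \<and>
           norm (V, W) \<le> C * err z powr \<kappa> \<and> norm E \<le> 2 * a * (err z)\<^sup>2)"
      using approximate_tangent_step by blast
    have rank_prd: "rank (prd z) \<le> CARD('r)" for z
      using rank_mul_le_left[of "fst z" "snd z"] rank_bound[of "fst z"] by linarith
    have near_ball: "\<forall>\<^sub>F z in near. prd z \<in> ball M e" if "0 < e" for e
      using tendsto_prd that by (intro topological_tendstoD) auto
    have ev_growth: "\<forall>\<^sub>F z in near. c * err z powr \<beta> \<le> g (prd z) - g M"
      using near_ball[OF \<delta>]
    proof eventually_elim
      case (elim z)
      then show ?case using growth[OF elim rank_prd] by simp
    qed
    have ev_subgrad: "\<forall>\<^sub>F z in near. \<forall>G \<in> convex_subdiff g (prd z).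
        norm G * (2 * a * (err z)\<^sup>2) \<le> (g (prd z) - g M) / 2"
      using cases
    proof (elim disjE conjE)
      assume "\<beta> < 2"
      obtain L where L: "\<And>y G. y \<in> ball M 1 \<Longrightarrow> G \<in> convex_subdiff g y \<Longrightarrow> norm G \<le> L"
        by (rule convex_subdiff_locally_bounded[OF A1, of M]) blast
      have "((\<lambda>z. prd z - M) \<longlongrightarrow> 0) near"
        using tendsto_diff[OF tendsto_prd tendsto_const, of M] by simp
      then have "((\<lambda>z. err z powr (2 - \<beta>)) \<longlongrightarrow> 0) near"
        using \<open>\<beta> < 2\<close> by (intro tendsto_zero_powrI[OF tendsto_norm_zero tendsto_const]) auto
      then have "((\<lambda>z. L * (2 * a) * err z powr (2 - \<beta>)) \<longlongrightarrow> 0) near"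
        by (rule tendsto_mult_right_zero)
      then have "\<forall>\<^sub>F z in near. L * (2 * a) * err z powr (2 - \<beta>) < c / 2"
        by (rule order_tendstoD) (use c in simp)
      then show ?thesis
        using ev_growth near_ball[OF zero_less_one]
      proof (eventually_elim, intro ballI)
        fix z G
        assume small: "L * (2 * a) * err z powr (2 - \<beta>) < c / 2"
          and growth: "c * err z powr \<beta> \<le> g (prd z) - g M"
          and ball: "prd z \<in> ball M 1" and G: "G \<in> convex_subdiff g (prd z)"
        have sq: "(err z)\<^sup>2 = err z powr (2 - \<beta>) * err z powr \<beta>"
          by (cases "err z = 0") (auto simp flip: powr_add)
        have "norm G * (2 * a * (err z)\<^sup>2) \<le> L * (2 * a * (err z)\<^sup>2)"
          using L[OF ball G] a_nonneg by (intro mult_right_mono) auto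
        also have "\<dots> = L * (2 * a) * err z powr (2 - \<beta>) * err z powr \<beta>"
          by (simp add: sq)
        also have "\<dots> \<le> c / 2 * err z powr \<beta>"
          using small by (intro mult_right_mono) auto
        finally show "norm G * (2 * a * (err z)\<^sup>2) \<le> (g (prd z) - g M) / 2"
          using growth by simp
      qed
    next
      assume \<beta>2: "\<beta> = 2" and sub: "\<forall>A \<in> ball M \<delta>. rank A \<le> CARD('r) \<longrightarrow>
          (SUP G \<in> convex_subdiff g A. ereal (norm G)) \<le> nth_singular_value s M * ereal c / 8"
      show ?thesis
        using ev_growth near_ball[OF \<delta>]
      proof (eventually_elim, intro ballI)
        fix z G
        assume growth: "c * err z powr \<beta> \<le> g (prd z) - g M"
          and ball: "prd z \<in> ball M \<delta>" and G: "G \<in> convex_subdiff g (prd z)"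
        have Ga: "norm G * a \<le> c / 8"
        proof (cases "s = 0")
          case True
          then show ?thesis using c by (simp add: a_def)
        next
          case False
          obtain \<sigma> where \<sigma>: "nth_singular_value s M = ereal \<sigma>" and \<sigma>_le: "\<And>k. k < s \<Longrightarrow> \<sigma> \<le> d k"
            using nth_singular_value_svd_le[OF svd s False] by blast
          obtain k where k: "k < s" "a = 1 / d k" using a_attained[OF False] by blast
          have "ereal (norm G) \<le> (SUP G \<in> convex_subdiff g (prd z). ereal (norm G))"
            by (rule SUP_upper[OF G])
          also have "\<dots> \<le> nth_singular_value s M * ereal c / 8"
            using sub ball rank_prd by blast
          also have "\<dots> = ereal (\<sigma> * c / 8)"
            by (simp add: \<sigma> numeral_eq_ereal)
          finally have "norm G \<le> \<sigma> * c / 8" by simp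
          also have "\<dots> \<le> d k * c / 8"
            using \<sigma>_le[OF k(1)] c by simp
          finally show ?thesis
            using d[OF k(1)] by (simp add: k(2) field_simps)
        qed
        have sq: "err z powr \<beta> = (err z)\<^sup>2" by (simp add: \<beta>2)
        have "norm G * (2 * a * (err z)\<^sup>2) = 2 * (norm G * a) * (err z)\<^sup>2" by simp
        also have "\<dots> \<le> c / 4 * (err z)\<^sup>2"
          using Ga by (intro mult_right_mono) auto
        also have "\<dots> \<le> c * (err z)\<^sup>2 / 2"
          using c by simp
        also have "\<dots> \<le> (g (prd z) - g M) / 2"
          using growth unfolding sq by (rule divide_right_mono) simp
        finally show "norm G * (2 * a * (err z)\<^sup>2) \<le> (g (prd z) - g M) / 2" .
      qed
    qed
    show ?thesis
      unfolding f_def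
      by (rule KL_exponent_from_tangent_steps[OF A1 factorization \<beta> \<kappa>01 a_nonneg c C ev_growth ev_subgrad step])
  qed
  have half: "1 - 1 / (2 * \<beta>) = 1 - (1 / 2) / \<beta>" by simp
  show ?thesis
    unfolding half using KL by blast
qed

end
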